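(* Let $(A,\circ)$ be a left-symmetric algebra over a field $\Bbbk$. Then $(A,\circ)$ embeds into a differential Perm-algebra $(P,d)$ in such a way that $a\circ b=a\,d(b)$ for all $a,b\in A$ if and only if $(A,\circ)$ embeds into a Novikov dialgebra $(N,\vdash,\dashv)$ in such a way that $a\vdash b=a\circ b$ for all $a,b\in A$.
   Context: $\Bbbk$ is an arbitrary field. A left-symmetric algebra is a linear space with a bilinear operation $\circ$ satisfying $(a,b,c)=(b,a,c)$, where $(a,b,c)=(a\circ b)\circ c-a\circ(b\circ c)$. A Perm-algebra is an associative (not necessarily unital) algebra satisfying $xyz=yxz$. A differential Perm-algebra is a pair $(P,d)$ with $P$ a Perm-algebra and $d$ a derivation of $P$. An embedding of $(A,\circ)$ into $(P,d)$ with $a\circ b=a\,d(b)$ means an injective linear map $\theta:A\to P$ with $\theta(a\circ b)=\theta(a)d(\theta(b))$; an embedding into $(N,\vdash,\dashv)$ with $a\vdash b=a\circ b$ means an injective linear map $\theta:A\to N$ with $\theta(a\circ b)=\theta(a)\vdash\theta(b)$. A Novikov dialgebra is a linear space $N$ with two bilinear operations $\vdash,\dashv$ such that for all $x_1,x_2,x_3\in N$: (0-identities) $(x_1\dashv x_2)\vdash x_3=(x_1\vdash x_2)\vdash x_3$, $\; x_1\dashv(x_2\vdash x_3)=x_1\dashv(x_2\dashv x_3)$; (left symmetry) $(x_1\dashv x_2)\dashv x_3-x_1\dashv(x_2\dashv x_3)=(x_2\vdash x_1)\dashv x_3-x_2\vdash(x_1\dashv x_3)$, $\;(x_1\vdash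 x_2)\vdash x_3-x_1\vdash(x_2\vdash x_3)=(x_2\vdash x_1)\vdash x_3-x_2\vdash(x_1\vdash x_3)$; (right commutativity) $(x_1\dashv x_2)\dashv x_3=(x_1\dashv x_3)\dashv x_2$, $\;(x_1\vdash x_2)\dashv x_3=(x_1\vdash x_3)\vdash x_2$. *)

theory Defs
  imports "HOL-Algebra.Module"
begin

text \<open>
  The \<open>module\<close> record and locale of HOL-Algebra supply the linear spaces. Only the additive and
  the scalar structure of such a record matters below: its multiplicative fields are never
  used, and the products of an algebra are separate functions, restricted to the carrier.
\<close>

definition linear_space :: "('k, 'm) ring_scheme \<Rightarrow> ('k, 'v, 'n) module_scheme \<Rightarrow> bool" where
  "linear_space K V \<longleftrightarrow> field K \<and> module K V"

definition linear_on ::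
  "('k, 'm) ring_scheme \<Rightarrow> ('k, 'v, 'n) module_scheme \<Rightarrow> ('k, 'w, 'l) module_scheme
    \<Rightarrow> ('v \<Rightarrow> 'w) \<Rightarrow> bool" where
  "linear_on K V W f \<longleftrightarrow>
     (\<forall>x\<in>carrier V. f x \<in> carrier W) \<and>
     (\<forall>x\<in>carrier V. \<forall>y\<in>carrier V. f (x \<oplus>\<^bsub>V\<^esub> y) = f x \<oplus>\<^bsub>W\<^esub> f y) \<and>
     (\<forall>c\<in>carrier K. \<forall>x\<in>carrier V. f (c \<odot>\<^bsub>V\<^esub> x) = c \<odot>\<^bsub>W\<^esub> f x)"

definition bilinear_op ::
  "('k, 'm) ring_scheme \<Rightarrow> ('k, 'v, 'n) module_scheme \<Rightarrow> ('v \<Rightarrow> 'v \<Rightarrow> 'v) \<Rightarrow> bool" where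
  "bilinear_op K V p \<longleftrightarrow>
     (\<forall>x\<in>carrier V. linear_on K V V (\<lambda>y. p x y)) \<and>
     (\<forall>y\<in>carrier V. linear_on K V V (\<lambda>x. p x y))"

definition left_symmetric_algebra ::
  "('k, 'm) ring_scheme \<Rightarrow> ('k, 'v, 'n) module_scheme \<Rightarrow> ('v \<Rightarrow> 'v \<Rightarrow> 'v) \<Rightarrow> bool" where
  "left_symmetric_algebra K A circ \<longleftrightarrow>
     linear_space K A \<and> bilinear_op K A circ \<and>
     (\<forall>a\<in>carrier A. \<forall>b\<in>carrier A. \<forall>c\<in>carrier A.
        circ (circ a b) c \<ominus>\<^bsub>A\<^esub> circ a (circ b c) = circ (circ b a) c \<ominus>\<^bsub>A\<^esub> circ b (circ a c))"

definition perm_algebra ::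
  "('k, 'm) ring_scheme \<Rightarrow> ('k, 'v, 'n) module_scheme \<Rightarrow> ('v \<Rightarrow> 'v \<Rightarrow> 'v) \<Rightarrow> bool" where
  "perm_algebra K P mul \<longleftrightarrow>
     linear_space K P \<and> bilinear_op K P mul \<and>
     (\<forall>x\<in>carrier P. \<forall>y\<in>carrier P. \<forall>z\<in>carrier P.
        mul (mul x y) z = mul x (mul y z) \<and> mul (mul x y) z = mul (mul y x) z)"

definition derivation ::
  "('k, 'm) ring_scheme \<Rightarrow> ('k, 'v, 'n) module_scheme \<Rightarrow> ('v \<Rightarrow> 'v \<Rightarrow> 'v) \<Rightarrow> ('v \<Rightarrow> 'v)
    \<Rightarrow> bool" where
  "derivation K P mul d \<longleftrightarrow>
     linear_on K P P d \<and>
     (\<forall>x\<in>carrier P. \<forall>y\<in>carrier P. d (mul x y) = mul (d x) y \<oplus>\<^bsub>P\<^esub> mul x (d y))"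

definition differential_perm_algebra ::
  "('k, 'm) ring_scheme \<Rightarrow> ('k, 'v, 'n) module_scheme \<Rightarrow> ('v \<Rightarrow> 'v \<Rightarrow> 'v) \<Rightarrow> ('v \<Rightarrow> 'v)
    \<Rightarrow> bool" where
  "differential_perm_algebra K P mul d \<longleftrightarrow> perm_algebra K P mul \<and> derivation K P mul d"

text \<open>In the following, \<open>l x y\<close> is $x \vdash y$ and \<open>r x y\<close> is $x \dashv y$.\<close>

definition novikov_dialgebra ::
  "('k, 'm) ring_scheme \<Rightarrow> ('k, 'v, 'n) module_scheme \<Rightarrow> ('v \<Rightarrow> 'v \<Rightarrow> 'v) \<Rightarrow> ('v \<Rightarrow> 'v \<Rightarrow> 'v)
    \<Rightarrow> bool" where
  "novikov_dialgebra K N l r \<longleftrightarrow>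
     linear_space K N \<and> bilinear_op K N l \<and> bilinear_op K N r \<and>
     (\<forall>x\<in>carrier N. \<forall>y\<in>carrier N. \<forall>z\<in>carrier N.
        l (r x y) z = l (l x y) z \<and>
        r x (l y z) = r x (r y z) \<and>
        r (r x y) z \<ominus>\<^bsub>N\<^esub> r x (r y z) = r (l y x) z \<ominus>\<^bsub>N\<^esub> l y (r x z) \<and>
        l (l x y) z \<ominus>\<^bsub>N\<^esub> l x (l y z) = l (l y x) z \<ominus>\<^bsub>N\<^esub> l y (l x z) \<and>
        r (r x y) z = r (r x z) y \<and>
        r (l x y) z = l (l x z) y)"

definition diff_perm_embedding ::
  "('k, 'm) ring_scheme \<Rightarrow> ('k, 'a, 'n) module_scheme \<Rightarrow> ('a \<Rightarrow> 'a \<Rightarrow> 'a)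
    \<Rightarrow> ('k, 'v, 'l) module_scheme \<Rightarrow> ('v \<Rightarrow> 'v \<Rightarrow> 'v) \<Rightarrow> ('v \<Rightarrow> 'v) \<Rightarrow> ('a \<Rightarrow> 'v) \<Rightarrow> bool" where
  "diff_perm_embedding K A circ P mul d \<theta> \<longleftrightarrow>
     linear_on K A P \<theta> \<and> inj_on \<theta> (carrier A) \<and>
     (\<forall>a\<in>carrier A. \<forall>b\<in>carrier A. \<theta> (circ a b) = mul (\<theta> a) (d (\<theta> b)))"

definition novikov_embedding ::
  "('k, 'm) ring_scheme \<Rightarrow> ('k, 'a, 'n) module_scheme \<Rightarrow> ('a \<Rightarrow> 'a \<Rightarrow> 'a)
    \<Rightarrow> ('k, 'v, 'l) module_scheme \<Rightarrow> ('v \<Rightarrow> 'v \<Rightarrow> 'v) \<Rightarrow> ('v \<Rightarrow> 'v \<Rightarrow> 'v) \<Rightarrow> ('a \<Rightarrow> 'v) \<Rightarrow> bool" where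
  "novikov_embedding K A circ N l r \<theta> \<longleftrightarrow>
     linear_on K A N \<theta> \<and> inj_on \<theta> (carrier A) \<and>
     (\<forall>a\<in>carrier A. \<forall>b\<in>carrier A. \<theta> (circ a b) = l (\<theta> a) (\<theta> b))"

text \<open>
  HOL cannot quantify existentially over types, so the algebra into which \<open>A\<close> is to be embedded
  ranges over all algebras with carrier in one fixed type, which is large enough: by
  \<open>embeds_in_diff_perm_algebraI\<close> and \<open>embeds_in_novikov_dialgebraI\<close> below, an embedding into
  an algebra over any type whatsoever yields one over this type.
\<close>

type_synonym ('k, 'a) univ = "(nat + 'k + 'a) list"

definition embeds_in_diff_perm_algebra ::
  "('k, 'm) ring_scheme \<Rightarrow> ('k, 'a, 'n) module_scheme \<Rightarrow> ('a \<Rightarrow> 'a \<Rightarrow> 'a) \<Rightarrow> bool" where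
  "embeds_in_diff_perm_algebra K A circ \<longleftrightarrow>
     (\<exists>(P :: ('k, ('k, 'a) univ) module) mul d \<theta>.
        differential_perm_algebra K P mul d \<and> diff_perm_embedding K A circ P mul d \<theta>)"

definition embeds_in_novikov_dialgebra ::
  "('k, 'm) ring_scheme \<Rightarrow> ('k, 'a, 'n) module_scheme \<Rightarrow> ('a \<Rightarrow> 'a \<Rightarrow> 'a) \<Rightarrow> bool" where
  "embeds_in_novikov_dialgebra K A circ \<longleftrightarrow>
     (\<exists>(N :: ('k, ('k, 'a) univ) module) l r \<theta>.
        novikov_dialgebra K N l r \<and> novikov_embedding K A circ N l r \<theta>)"


section \<open>The fixed carrier type is large enough\<close>

text \<open>
  The subalgebra generated by the image of \<open>A\<close> consists of the values of terms, and
  terms in Polish notation are elements of the fixed type.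
\<close>

datatype ('k, 'a) trm =
    Gen 'a
  | Scl 'k "('k, 'a) trm"
  | Op "('k, 'a) trm"
  | Add "('k, 'a) trm" "('k, 'a) trm"
  | Bin1 "('k, 'a) trm" "('k, 'a) trm"
  | Bin2 "('k, 'a) trm" "('k, 'a) trm"

primrec polish :: "('k, 'a) trm \<Rightarrow> ('k, 'a) univ" where
  "polish (Gen a) = [Inr (Inr a)]"
| "polish (Scl c t) = Inr (Inl c) # polish t"
| "polish (Op t) = Inl 0 # polish t"
| "polish (Add s t) = Inl 1 # polish s @ polish t"
| "polish (Bin1 s t) = Inl 2 # polish s @ polish t"
| "polish (Bin2 s t) = Inl 3 # polish s @ polish t"

lemma polish_append_inject: "polish s @ xs = polish t @ ys \<longleftrightarrow> s = t \<and> xs = ys"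
proof (induction s arbitrary: t xs ys)
  case (Gen a) show ?case by (cases t) auto
next
  case (Scl c s) then show ?case by (cases t) auto
next
  case (Op s) then show ?case by (cases t) auto
next
  case (Add s1 s2) then show ?case by (cases t) auto
next
  case (Bin1 s1 s2) then show ?case by (cases t) auto
next
  case (Bin2 s1 s2) then show ?case by (cases t) auto
qed

lemma inj_polish: "inj polish"
  using polish_append_inject[where xs = "[]" and ys = "[]"] by (auto intro: injI)

lemma generated_subset:
  fixes K :: "('k, 'm) ring_scheme" and V :: "('k, 'v, 'n) module_scheme"
    and A :: "'a set" and \<theta> :: "'a \<Rightarrow> 'v"
  assumes V: "module K V" and "A \<noteq> {}"
    and \<theta>: "\<forall>a\<in>A. \<theta> a \<in> carrier V"
    and u: "\<forall>x\<in>carrier V. u x \<in> carrier V"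
    and p: "\<forall>x\<in>carrier V. \<forall>y\<in>carrier V. p x y \<in> carrier V"
    and q: "\<forall>x\<in>carrier V. \<forall>y\<in>carrier V. q x y \<in> carrier V"
  obtains S and f :: "'v \<Rightarrow> ('k, 'a) univ" where
    "S \<subseteq> carrier V" "\<forall>a\<in>A. \<theta> a \<in> S" "\<zero>\<^bsub>V\<^esub> \<in> S"
    "\<forall>x\<in>S. \<forall>y\<in>S. x \<oplus>\<^bsub>V\<^esub> y \<in> S" "\<forall>c\<in>carrier K. \<forall>x\<in>S. c \<odot>\<^bsub>V\<^esub> x \<in> S"
    "\<forall>x\<in>S. u x \<in> S" "\<forall>x\<in>S. \<forall>y\<in>S. p x y \<in> S" "\<forall>x\<in>S. \<forall>y\<in>S. q x y \<in> S" "inj_on f S"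
proof -
  interpret module K V by (rule V)
  define val where "val = rec_trm \<theta> (\<lambda>c _ x. c \<odot>\<^bsub>V\<^esub> x) (\<lambda>_ x. u x)
    (\<lambda>_ _ x y. x \<oplus>\<^bsub>V\<^esub> y) (\<lambda>_ _ x y. p x y) (\<lambda>_ _ x y. q x y)"
  have val: "val (Gen a) = \<theta> a" "val (Scl c t) = c \<odot>\<^bsub>V\<^esub> val t" "val (Op t) = u (val t)"
    "val (Add s t) = val s \<oplus>\<^bsub>V\<^esub> val t" "val (Bin1 s t) = p (val s) (val t)"
    "val (Bin2 s t) = q (val s) (val t)" for a c s t
    by (simp_all add: val_def)
  define ok where "ok t \<longleftrightarrow> set1_trm t \<subseteq> carrier K \<and> set2_trm t \<subseteq> A" for t
  have val_closed: "ok t \<Longrightarrow> val t \<in> carrier V" for t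
    by (induction t) (use \<theta> u p q in \<open>auto simp: val ok_def\<close>)
  define S where "S = {val t | t. ok t}"
  define f where "f x = polish (SOME t. ok t \<and> val t = x)" for x
  have val_some: "val (SOME t. ok t \<and> val t = x) = x" if "x \<in> S" for x
    using someI_ex[of "\<lambda>t. ok t \<and> val t = x"] that by (auto simp: S_def)
  have inS: "\<exists>t. ok t \<and> x = val t \<Longrightarrow> x \<in> S" for x by (auto simp: S_def)
  have gen: "\<theta> a \<in> S" if "a \<in> A" for a
    by (rule inS, rule exI[of _ "Gen a"]) (use that in \<open>auto simp: val ok_def\<close>)
  have sub: "S \<subseteq> carrier V" using val_closed by (auto simp: S_def)
  have scl: "c \<odot>\<^bsub>V\<^esub> x \<in> S" if cx: "c \<in> carrier K" "x \<in> S" for c x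
  proof -
    obtain t where "ok t" "x = val t" using cx by (auto simp: S_def)
    then show ?thesis
      by (intro inS exI[of _ "Scl c t"]) (use cx in \<open>auto simp: val ok_def\<close>)
  qed
  have un: "u x \<in> S" if x: "x \<in> S" for x
  proof -
    obtain t where "ok t" "x = val t" using x by (auto simp: S_def)
    then show ?thesis by (intro inS exI[of _ "Op t"]) (auto simp: val ok_def)
  qed
  have bin: "x \<oplus>\<^bsub>V\<^esub> y \<in> S" "p x y \<in> S" "q x y \<in> S" if xy: "x \<in> S" "y \<in> S" for x y
  proof -
    obtain s t where st: "ok s" "x = val s" "ok t" "y = val t" using xy by (auto simp: S_def)
    show "x \<oplus>\<^bsub>V\<^esub> y \<in> S" by (intro inS exI[of _ "Add s t"]) (use st in \<open>auto simp: val ok_def\<close>)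
    show "p x y \<in> S" by (intro inS exI[of _ "Bin1 s t"]) (use st in \<open>auto simp: val ok_def\<close>)
    show "q x y \<in> S" by (intro inS exI[of _ "Bin2 s t"]) (use st in \<open>auto simp: val ok_def\<close>)
  qed
  obtain a where "a \<in> A" using \<open>A \<noteq> {}\<close> by auto
  then have "\<zero>\<^bsub>K\<^esub> \<odot>\<^bsub>V\<^esub> \<theta> a \<in> S" using gen scl by auto
  then have zero: "\<zero>\<^bsub>V\<^esub> \<in> S" using \<open>a \<in> A\<close> \<theta> by simp
  have "inj_on f S"
  proof (rule inj_onI)
    fix x y assume xy: "x \<in> S" "y \<in> S" "f x = f y"
    have "(SOME t. ok t \<and> val t = x) = (SOME t. ok t \<and> val t = y)"
      by (rule injD[OF inj_polish]) (use xy(3) in \<open>simp only: f_def\<close>)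
    then have "val (SOME t. ok t \<and> val t = x) = val (SOME t. ok t \<and> val t = y)"
      by (rule arg_cong)
    then show "x = y" by (simp only: val_some[OF xy(1)] val_some[OF xy(2)])
  qed
  show thesis
  proof (rule that[of S f])
    show "S \<subseteq> carrier V" "\<zero>\<^bsub>V\<^esub> \<in> S" by (rule sub zero)+
    show "inj_on f S" by fact
  qed (simp_all add: gen scl un bin)
qed

locale transport = V?: module K V
  for K :: "('k, 'm) ring_scheme" (structure)
    and V :: "('k, 'v, 'n) module_scheme" (structure) +
  fixes S :: "'v set" and f :: "'v \<Rightarrow> 'w"
  assumes S_sub: "S \<subseteq> carrier V" and S_zero: "\<zero>\<^bsub>V\<^esub> \<in> S"
    and S_add: "\<forall>x\<in>S. \<forall>y\<in>S. x \<oplus>\<^bsub>V\<^esub> y \<in> S"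
    and S_smult: "\<forall>c\<in>carrier K. \<forall>x\<in>S. c \<odot>\<^bsub>V\<^esub> x \<in> S"
    and inj: "inj_on f S"
begin

abbreviation g where "g \<equiv> inv_into S f"

definition V' :: "('k, 'w) module" where
  "V' = \<lparr>carrier = f ` S, mult = (\<lambda>x y. undefined), one = undefined,
    zero = f \<zero>\<^bsub>V\<^esub>, add = (\<lambda>x y. f (g x \<oplus>\<^bsub>V\<^esub> g y)),
    smult = (\<lambda>c x. f (c \<odot>\<^bsub>V\<^esub> g x))\<rparr>"

lemma gf: "x \<in> S \<Longrightarrow> g (f x) = x"
  using inj by simp

lemma V': "carrier V' = f ` S" "\<zero>\<^bsub>V'\<^esub> = f \<zero>\<^bsub>V\<^esub>"
  "x \<in> S \<Longrightarrow> y \<in> S \<Longrightarrow> f x \<oplus>\<^bsub>V'\<^esub> f y = f (x \<oplus>\<^bsub>V\<^esub> y)"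
  "x \<in> S \<Longrightarrow> c \<odot>\<^bsub>V'\<^esub> f x = f (c \<odot>\<^bsub>V\<^esub> x)"
  by (simp_all add: V'_def gf)

lemma in_V [simp]: "x \<in> S \<Longrightarrow> x \<in> carrier V"
  using S_sub by auto

lemma S_uminus: "x \<in> S \<Longrightarrow> \<ominus>\<^bsub>V\<^esub> x \<in> S"
  using S_smult smult_l_minus[of "\<one>" x] by (metis R.add.inv_closed R.one_closed in_V smult_one)

lemma abelian_group_V': "abelian_group V'"
proof (rule abelian_groupI)
  fix x assume "x \<in> carrier V'"
  then obtain s where s: "s \<in> S" "x = f s" by (auto simp: V')
  then show "\<exists>y\<in>carrier V'. y \<oplus>\<^bsub>V'\<^esub> x = \<zero>\<^bsub>V'\<^esub>"
    by (intro bexI[of _ "f (\<ominus>\<^bsub>V\<^esub> s)"]) (auto simp: V' S_uminus M.l_neg)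
qed (auto simp: V' S_add S_zero M.a_ac)

lemma module_V': "module K V'"
  by (rule moduleI)
    (auto simp: V' S_add S_smult abelian_group_V' R.is_cring
      smult_l_distr smult_r_distr smult_assoc1)

lemma V'_minus: "x \<in> S \<Longrightarrow> y \<in> S \<Longrightarrow> f x \<ominus>\<^bsub>V'\<^esub> f y = f (x \<ominus>\<^bsub>V\<^esub> y)"
proof -
  assume xy: "x \<in> S" "y \<in> S"
  interpret V': abelian_group V' by (rule abelian_group_V')
  have "\<ominus>\<^bsub>V'\<^esub> f y = f (\<ominus>\<^bsub>V\<^esub> y)"
    by (rule V'.minus_equality) (use xy in \<open>auto simp: V' S_uminus M.l_neg\<close>)
  then show ?thesis using xy by (simp add: a_minus_def V' S_uminus)
qed

lemma linear_on_V':
  assumes "linear_on K V V h" "\<forall>x\<in>S. h x \<in> S"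
  shows "linear_on K V' V' (\<lambda>x. f (h (g x)))"
  using assms by (auto simp: linear_on_def V' gf S_add S_smult)

lemma bilinear_op_V':
  assumes "bilinear_op K V p" "\<forall>x\<in>S. \<forall>y\<in>S. p x y \<in> S"
  shows "bilinear_op K V' (\<lambda>x y. f (p (g x) (g y)))"
  using assms by (auto simp: bilinear_op_def linear_on_def V' gf S_add S_smult)

lemma linear_on_into_V':
  assumes "linear_on K A V \<theta>" "\<forall>a\<in>carrier A. \<theta> a \<in> S"
  shows "linear_on K A V' (\<lambda>a. f (\<theta> a))"
  using assms by (auto simp: linear_on_def V')

lemma inj_on_V': "inj_on \<theta> B \<Longrightarrow> \<forall>a\<in>B. \<theta> a \<in> S \<Longrightarrow> inj_on (\<lambda>a. f (\<theta> a)) B"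
  using inj by (auto simp: inj_on_def)

end

lemma linear_on_closed: "linear_on K V W h \<Longrightarrow> \<forall>x\<in>carrier V. h x \<in> carrier W"
  by (simp add: linear_on_def)

lemma bilinear_op_closed:
  "bilinear_op K V p \<Longrightarrow> \<forall>x\<in>carrier V. \<forall>y\<in>carrier V. p x y \<in> carrier V"
  by (simp add: bilinear_op_def linear_on_def)

lemma linear_space_carrier_nonempty: "linear_space K A \<Longrightarrow> carrier A \<noteq> {}"
  by (metis abelian_group_def abelian_monoid.zero_closed empty_iff linear_space_def module_def)

theorem embeds_in_diff_perm_algebraI:
  fixes K :: "('k, 'm) ring_scheme" and A :: "('k, 'a, 'n) module_scheme"
    and P :: "('k, 'v, 'l) module_scheme"
  assumes A: "linear_space K A"
    and P: "differential_perm_algebra K P mul d"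
    and \<theta>: "diff_perm_embedding K A circ P mul d \<theta>"
  shows "embeds_in_diff_perm_algebra K A circ"
proof -
  have K: "field K" and mod: "module K P" and mul: "bilinear_op K P mul" and d: "linear_on K P P d"
    using P by (auto simp: differential_perm_algebra_def perm_algebra_def derivation_def
        linear_space_def)
  have \<theta>_lin: "linear_on K A P \<theta>" and \<theta>_inj: "inj_on \<theta> (carrier A)"
    using \<theta> by (auto simp: diff_perm_embedding_def)
  obtain S and f :: "'v \<Rightarrow> ('k, 'a) univ" where S:
    "S \<subseteq> carrier P" "\<forall>a\<in>carrier A. \<theta> a \<in> S" "\<zero>\<^bsub>P\<^esub> \<in> S"
    "\<forall>x\<in>S. \<forall>y\<in>S. x \<oplus>\<^bsub>P\<^esub> y \<in> S" "\<forall>c\<in>carrier K. \<forall>x\<in>S. c \<odot>\<^bsub>P\<^esub> x \<in> S"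
    "\<forall>x\<in>S. d x \<in> S" "\<forall>x\<in>S. \<forall>y\<in>S. mul x y \<in> S" "inj_on f S"
  proof (rule generated_subset[where A = "carrier A" and \<theta> = \<theta> and u = d and p = mul and q = mul])
    show "module K P" by (rule mod)
    show "carrier A \<noteq> {}" by (rule linear_space_carrier_nonempty[OF A])
    show "\<forall>a\<in>carrier A. \<theta> a \<in> carrier P" by (rule linear_on_closed[OF \<theta>_lin])
  qed (use mul d in \<open>simp_all add: bilinear_op_closed linear_on_closed\<close>)
  interpret transport K P S f
    using S mod by (simp add: transport_def transport_axioms_def)
  let ?mul = "\<lambda>x y. f (mul (g x) (g y))" and ?d = "\<lambda>x. f (d (g x))" and ?\<theta> = "\<lambda>a. f (\<theta> a)"
  have "differential_perm_algebra K V' ?mul ?d"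
    unfolding differential_perm_algebra_def perm_algebra_def derivation_def linear_space_def
  proof (intro conjI K module_V' bilinear_op_V' linear_on_V' mul d S)
    show "\<forall>x\<in>carrier V'. \<forall>y\<in>carrier V'. \<forall>z\<in>carrier V'.
        ?mul (?mul x y) z = ?mul x (?mul y z) \<and> ?mul (?mul x y) z = ?mul (?mul y x) z"
    proof (intro ballI)
      fix x y z assume "x \<in> carrier V'" "y \<in> carrier V'" "z \<in> carrier V'"
      then obtain a b c where abc: "a \<in> S" "b \<in> S" "c \<in> S" "x = f a" "y = f b" "z = f c"
        by (auto simp: V')
      have eqs: "mul (mul a b) c = mul a (mul b c)" "mul (mul a b) c = mul (mul b a) c"
        using P abc(1-3) in_V unfolding differential_perm_algebra_def perm_algebra_def by blast+
      show "?mul (?mul x y) z = ?mul x (?mul y z) \<and> ?mul (?mul x y) z = ?mul (?mul y x) z"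
        by (simp only: abc gf S(7)[rule_format]) (rule conjI; rule arg_cong[where f = f], rule eqs)
    qed
    show "\<forall>x\<in>carrier V'. \<forall>y\<in>carrier V'.
        ?d (?mul x y) = ?mul (?d x) y \<oplus>\<^bsub>V'\<^esub> ?mul x (?d y)"
      using P S by (auto simp: V' gf differential_perm_algebra_def derivation_def)
  qed
  moreover have "diff_perm_embedding K A circ V' ?mul ?d ?\<theta>"
    using \<theta> S linear_on_into_V' inj_on_V' by (auto simp: diff_perm_embedding_def gf)
  ultimately show ?thesis unfolding embeds_in_diff_perm_algebra_def by blast
qed

theorem embeds_in_novikov_dialgebraI:
  fixes K :: "('k, 'm) ring_scheme" and A :: "('k, 'a, 'n) module_scheme"
    and N :: "('k, 'v, 'l) module_scheme"
  assumes A: "linear_space K A"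
    and N: "novikov_dialgebra K N l r"
    and \<theta>: "novikov_embedding K A circ N l r \<theta>"
  shows "embeds_in_novikov_dialgebra K A circ"
proof -
  have K: "field K" and mod: "module K N" and l: "bilinear_op K N l" and r: "bilinear_op K N r"
    using N by (auto simp: novikov_dialgebra_def linear_space_def)
  have \<theta>_lin: "linear_on K A N \<theta>" and \<theta>_inj: "inj_on \<theta> (carrier A)"
    using \<theta> by (auto simp: novikov_embedding_def)
  obtain S and f :: "'v \<Rightarrow> ('k, 'a) univ" where S:
    "S \<subseteq> carrier N" "\<forall>a\<in>carrier A. \<theta> a \<in> S" "\<zero>\<^bsub>N\<^esub> \<in> S"
    "\<forall>x\<in>S. \<forall>y\<in>S. x \<oplus>\<^bsub>N\<^esub> y \<in> S" "\<forall>c\<in>carrier K. \<forall>x\<in>S. c \<odot>\<^bsub>N\<^esub> x \<in> S"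
    "\<forall>x\<in>S. \<forall>y\<in>S. l x y \<in> S" "\<forall>x\<in>S. \<forall>y\<in>S. r x y \<in> S" "inj_on f S"
  proof (rule generated_subset[where A = "carrier A" and \<theta> = \<theta> and u = "\<lambda>x. x" and p = l and q = r])
    show "module K N" by (rule mod)
    show "carrier A \<noteq> {}" by (rule linear_space_carrier_nonempty[OF A])
    show "\<forall>a\<in>carrier A. \<theta> a \<in> carrier N" by (rule linear_on_closed[OF \<theta>_lin])
  qed (use l r in \<open>simp_all add: bilinear_op_closed linear_on_closed\<close>)
  interpret transport K N S f
    using S mod by (simp add: transport_def transport_axioms_def)
  let ?l = "\<lambda>x y. f (l (g x) (g y))" and ?r = "\<lambda>x y. f (r (g x) (g y))" and ?\<theta> = "\<lambda>a. f (\<theta> a)"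
  have "novikov_dialgebra K V' ?l ?r"
    unfolding novikov_dialgebra_def linear_space_def
  proof (intro conjI K module_V' bilinear_op_V' l r S)
    show "\<forall>x\<in>carrier V'. \<forall>y\<in>carrier V'. \<forall>z\<in>carrier V'.
        ?l (?r x y) z = ?l (?l x y) z \<and>
        ?r x (?l y z) = ?r x (?r y z) \<and>
        ?r (?r x y) z \<ominus>\<^bsub>V'\<^esub> ?r x (?r y z) = ?r (?l y x) z \<ominus>\<^bsub>V'\<^esub> ?l y (?r x z) \<and>
        ?l (?l x y) z \<ominus>\<^bsub>V'\<^esub> ?l x (?l y z) = ?l (?l y x) z \<ominus>\<^bsub>V'\<^esub> ?l y (?l x z) \<and>
        ?r (?r x y) z = ?r (?r x z) y \<and>
        ?r (?l x y) z = ?l (?l x z) y" (is "\<forall>x\<in>_. \<forall>y\<in>_. \<forall>z\<in>_. ?Q x y z")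
    proof (intro ballI)
      fix x y z assume "x \<in> carrier V'" "y \<in> carrier V'" "z \<in> carrier V'"
      then obtain a b c where abc: "a \<in> S" "b \<in> S" "c \<in> S" "x = f a" "y = f b" "z = f c"
        by (auto simp: V')
      have eqs:
        "l (r a b) c = l (l a b) c"
        "r a (l b c) = r a (r b c)"
        "r (r a b) c \<ominus>\<^bsub>N\<^esub> r a (r b c) = r (l b a) c \<ominus>\<^bsub>N\<^esub> l b (r a c)"
        "l (l a b) c \<ominus>\<^bsub>N\<^esub> l a (l b c) = l (l b a) c \<ominus>\<^bsub>N\<^esub> l b (l a c)"
        "r (r a b) c = r (r a c) b"
        "r (l a b) c = l (l a c) b"
        using N abc(1-3) in_V unfolding novikov_dialgebra_def by blast+
      show "?Q x y z"
        by (simp only: abc gf V'_minus S(6,7)[rule_format])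
          (intro conjI; rule arg_cong[where f = f], rule eqs)
    qed
  qed
  moreover have "novikov_embedding K A circ V' ?l ?r ?\<theta>"
    using \<theta> S linear_on_into_V' inj_on_V' by (auto simp: novikov_embedding_def gf)
  ultimately show ?thesis unfolding embeds_in_novikov_dialgebra_def by blast
qed

end

theory Submission
  imports Defs
begin

text \<open>
  A differential Perm-algebra is a Novikov dialgebra under $x \vdash y = x\,d(y)$ and
  $x \dashv y = d(y)\,x$. For the converse it is enough to embed a Novikov dialgebra $N$. In a
  differential Perm-algebra the product $a_1^{(k_1)} \cdots a_m^{(k_m)}\, c^{(n)}$ has weight
  $\sum (k_i - 1) + n - 1$, and if it contains $N$ with the right operations, then its part of weight
  $-1$ acts inside $N$: operators $\dashv b$ stand for multiplication by $b'$, and an element $g$ of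
  weight $n - 1$ is visible through the symmetric multilinear map
  $(a_1, \dots, a_n) \mapsto a_1 \cdots a_n\, g \in N$. On such maps the derivation and
  the multiplications by $b^{(k)}$, $k \ge 1$, can be written down without knowing the algebra, and
  left symmetry and right commutativity are what makes the results symmetric and the multiplications
  commute. Reading off values at $(a_1, \dots, a_n)$ yields a consistent system of values for all
  products of weight $-1$. The algebra is then recovered as an algebra of operators on functions of
  such products, extended by Hurwitz sequences so that a derivation exists in every characteristic,
  together with the module that the operators act on: $(T, F)(T', F') = (T T', T F')$ is a Perm product
  as soon as the operators commute.
\<close>

section \<open>Abelian groups with total operations\<close>

text \<open>
  The operations see an argument outside \<open>C\<close> as zero. Hence all laws but those that return an
  argument unchanged hold without membership conditions.
\<close>

type_synonym 'x seq = "nat \<Rightarrow> ('x \<times> nat) list \<Rightarrow> 'x"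
type_synonym 'x op = "'x seq \<Rightarrow> 'x seq"

locale total_group =
  fixes C :: "'n set" and p mi :: "'n \<Rightarrow> 'n \<Rightarrow> 'n" and z :: 'n
  assumes p_closed [simp]: "p x y \<in> C" and mi_closed [simp]: "mi x y \<in> C"
    and z_closed [simp]: "z \<in> C"
    and p_comm: "p x y = p y x" and p_assoc: "p (p x y) w = p x (p y w)"
    and p_z [simp]: "x \<in> C \<Longrightarrow> p x z = x"
    and p_mi: "p x (mi y w) = mi (p x y) w"
    and mi_mi: "mi (mi x y) w = mi x (p y w)"
    and mi_mi2: "mi x (mi y w) = mi (p x w) y"
    and mi_eq_mi: "mi x y = mi v w \<longleftrightarrow> p x w = p v y"
    and mi_eq: "x \<in> C \<Longrightarrow> v \<in> C \<Longrightarrow> mi x y = v \<longleftrightarrow> x = p v y"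
begin

lemma p_left_comm: "p x (p y w) = p y (p x w)"
  by (metis p_comm p_assoc)

lemmas p_ac = p_assoc p_comm p_left_comm

lemma mi_p: "p (mi x y) w = mi (p x w) y"
  by (metis p_comm p_mi)

lemma eq_mi:
  "x \<in> C \<Longrightarrow> v \<in> C \<Longrightarrow> v = mi x y \<longleftrightarrow> p v y = x"
  using mi_eq by metis

lemma z_p [simp]: "x \<in> C \<Longrightarrow> p z x = x"
  by (metis p_comm p_z)

lemma p_p_z [simp]: "p x (p y z) = p x y"
  by (metis p_assoc p_closed p_z)

lemma mi_self [simp]: "mi x x = z"
proof -
  have "mi x x = mi z z" by (simp add: mi_eq_mi p_comm)
  then show ?thesis by (simp add: mi_eq)
qed

lemma mi_z [simp]: "x \<in> C \<Longrightarrow> mi x z = x"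
  by (simp add: mi_eq)

lemmas grp = p_mi mi_p mi_mi mi_mi2 mi_eq_mi mi_eq eq_mi p_ac

lemma p_cancel:
  "x \<in> C \<Longrightarrow> y \<in> C \<Longrightarrow> p x w = p y w \<longleftrightarrow> x = y"
  by (metis mi_eq p_closed mi_p mi_self p_mi p_z z_closed)

lemma mi_cancel: "x \<in> C \<Longrightarrow> mi (p x y) y = x"
  by (simp add: mi_eq)

text \<open>
  If \<open>G k j\<close> is $x^{(k)} y^{(j)}$, then \<open>leibniz n G k j\<close> is its \<open>n\<close>-th derivative. The recursion
  avoids binomial coefficients.
\<close>

primrec leibniz :: "nat \<Rightarrow> (nat \<Rightarrow> nat \<Rightarrow> 'n) \<Rightarrow> nat \<Rightarrow> nat \<Rightarrow> 'n" where
  "leibniz 0 G k j = G k j"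
| "leibniz (Suc n) G k j = p (leibniz n G (Suc k) j) (leibniz n G k (Suc j))"

lemma leibniz_closed: "(\<And>k j. G k j \<in> C) \<Longrightarrow> leibniz n G k j \<in> C"
  by (cases n) auto

lemma leibniz_p:
  "leibniz n (\<lambda>k j. p (G k j) (H k j)) k j = p (leibniz n G k j) (leibniz n H k j)"
  by (induction n arbitrary: k j) (simp_all add: p_ac)

lemma leibniz_mi:
  "leibniz n (\<lambda>k j. mi (G k j) (H k j)) k j = mi (leibniz n G k j) (leibniz n H k j)"
  by (induction n arbitrary: k j) (simp_all add: grp)

lemma leibniz_z [simp]: "leibniz n (\<lambda>k j. z) k j = z"
  by (induction n arbitrary: k j) simp_all

lemma leibniz_hom:
  "(\<And>x y. f (p x y) = p (f x) (f y)) \<Longrightarrow> f (leibniz n G k j) = leibniz n (\<lambda>k j. f (G k j)) k j"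
  by (induction n arbitrary: k j) simp_all

text \<open>Unfolding \<open>leibniz n G k j\<close> reaches only the entries at distance n from (k,
  j), each with its binomial multiplicity.\<close>

lemma leibniz_cong:
  assumes "\<And>i i'. i + i' = n \<Longrightarrow> G (k + i) (j + i') = H (k + i) (j + i')"
  shows "leibniz n G k j = leibniz n H k j"
  using assms
proof (induction n arbitrary: k j)
  case 0
  from 0[of 0 0] show ?case by simp
next
  case (Suc n)
  have "leibniz n G (Suc k) j = leibniz n H (Suc k) j"
  proof (rule Suc.IH)
    fix i i' assume "i + i' = n"
    then show "G (Suc k + i) (j + i') = H (Suc k + i) (j + i')" using Suc.prems[of "Suc i" i'] by simp
  qed
  moreover have "leibniz n G k (Suc j) = leibniz n H k (Suc j)"
  proof (rule Suc.IH)
    fix i i' assume "i + i' = n"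
    then show "G (k + i) (Suc j + i') = H (k + i) (Suc j + i')" using Suc.prems[of i "Suc i'"] by simp
  qed
  ultimately show ?case by simp
qed

text \<open>The entry \<open>G k (j + n)\<close> occurs with multiplicity one, so it can be isolated
  in every characteristic.\<close>

lemma leibniz_single:
  assumes "\<And>i i'. i + i' = n \<Longrightarrow> 0 < i \<Longrightarrow> G (k + i) (j + i') = z" "G k (j + n) \<in> C"
  shows "leibniz n G k j = G k (j + n)"
proof -
  let ?H = "\<lambda>i j'. if i = k then G k (j + n) else z"
  have "leibniz n G k j = leibniz n ?H k j"
  proof (rule leibniz_cong)
    fix i i' assume "i + i' = n"
    then show "G (k + i) (j + i') = ?H (k + i) (j + i')" using assms(1)[of i i'] by (cases "i = 0") auto
  qed
  also have "leibniz m ?H k' j' = (if k' = k then G k (j + n) else z)" if "k \<le> k'" for m k' j'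
    using that assms(2) by (induction m arbitrary: k' j') auto
  then have "leibniz n ?H k j = G k (j + n)" by simp
  finally show ?thesis .
qed

lemma leibniz_shift: "leibniz n (\<lambda>k j. G k (Suc j)) k j = leibniz n G k (Suc j)"
  by (induction n arbitrary: k j) simp_all

lemma leibniz_shift': "leibniz n (\<lambda>k j. G (Suc k) j) k j = leibniz n G (Suc k) j"
  by (induction n arbitrary: k j) simp_all

end

section \<open>Multilinear maps as elements of weight at least -1\<close>

locale total_novikov = total_group C p mi z + K?: field K
  for C :: "'n set" and p mi :: "'n \<Rightarrow> 'n \<Rightarrow> 'n" and z :: 'n
    and K :: "('k, 'm) ring_scheme" +
  fixes sc :: "'k \<Rightarrow> 'n \<Rightarrow> 'n" and l r :: "'n \<Rightarrow> 'n \<Rightarrow> 'n"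
  assumes sc_closed [simp]: "c \<in> carrier K \<Longrightarrow> sc c x \<in> C"
    and sc_p: "c \<in> carrier K \<Longrightarrow> sc c (p x y) = p (sc c x) (sc c y)"
    and sc_add: "c \<in> carrier K \<Longrightarrow> c' \<in> carrier K \<Longrightarrow> sc (c \<oplus>\<^bsub>K\<^esub> c') x = p (sc c x) (sc c' x)"
    and sc_mult: "c \<in> carrier K \<Longrightarrow> c' \<in> carrier K \<Longrightarrow> sc (c \<otimes>\<^bsub>K\<^esub> c') x = sc c (sc c' x)"
    and sc_one [simp]: "x \<in> C \<Longrightarrow> sc \<one>\<^bsub>K\<^esub> x = x"
    and l_closed [simp]: "l x y \<in> C" and r_closed [simp]: "r x y \<in> C"
    and l_p: "l x (p y w) = p (l x y) (l x w)" and p_l: "l (p x y) w = p (l x w) (l y w)"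
    and r_p: "r x (p y w) = p (r x y) (r x w)" and p_r: "r (p x y) w = p (r x w) (r y w)"
    and l_sc: "c \<in> carrier K \<Longrightarrow> l x (sc c y) = sc c (l x y)"
    and sc_l: "c \<in> carrier K \<Longrightarrow> l (sc c x) y = sc c (l x y)"
    and r_sc: "c \<in> carrier K \<Longrightarrow> r x (sc c y) = sc c (r x y)"
    and sc_r: "c \<in> carrier K \<Longrightarrow> r (sc c x) y = sc c (r x y)"
    and l_r: "l (r x y) w = l (l x y) w" and r_l: "r x (l y w) = r x (r y w)"
    and lsym_r: "p (r (r x y) w) (l y (r x w)) = p (r (l y x) w) (r x (r y w))"
    and lsym_l: "p (l (l x y) w) (l y (l x w)) = p (l (l y x) w) (l x (l y w))"
    and rcomm_r: "r (r x y) w = r (r x w) y"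
    and rcomm_l: "r (l x y) w = l (l x w) y"
begin

lemma hom_mi:
  assumes "\<And>x y. f (p x y) = p (f x) (f y)" "\<And>x. f x \<in> C"
  shows "f (mi x y) = mi (f x) (f y)"
proof -
  have "p (f (mi x y)) (f y) = f (p (mi x y) y)" by (simp add: assms)
  \<comment> \<open>As \<open>x\<close> may lie outside \<open>C\<close>, \<open>p x z\<close> need
    not be \<open>x\<close>; the difference disappears only under \<open>f\<close>.\<close>
  also have "p (mi x y) y = p x z" by (simp add: grp)
  also have "f (p x z) = p (f x) (f z)" by (simp add: assms)
  also have "f z = z"
    by (metis assms mi_eq mi_self p_z z_closed)
  finally show ?thesis by (simp add: eq_mi assms(2))
qed

lemma l_mi: "l x (mi y w) = mi (l x y) (l x w)" by (rule hom_mi) (simp_all add: l_p)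
lemma mi_r:
  "r (mi x y) w = mi (r x w) (r y w)" by (rule hom_mi[of "\<lambda>x. r x w"]) (simp_all add: p_r)
lemma sc_mi:
  "c \<in> carrier K \<Longrightarrow> sc c (mi y w) = mi (sc c y) (sc c w)" by (rule hom_mi) (simp_all add: sc_p)
lemma l_z [simp]: "l x z = z" using l_mi[of x z z] by simp
lemma z_r [simp]: "r z x = z" using mi_r[of z z x] by simp
lemma sc_z [simp]: "c \<in> carrier K \<Longrightarrow> sc c z = z" using sc_mi[of c z z] by simp

section \<open>The operators x d on multilinear maps\<close>

text \<open>
  The operator $x\,d$ of weight $0$: with $\iota_y$ denoting insertion of \<open>y\<close> as first argument, it is
  determined by $\iota_y \circ x d = x d \circ \iota_y - \iota_{x \vdash y}$.
\<close>

primrec lie :: "'n \<Rightarrow> 'n list \<Rightarrow> ('n list \<Rightarrow> 'n) \<Rightarrow> 'n" where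
  "lie x [] g = l x (g [])"
| "lie x (y # ys) g = mi (lie x ys (\<lambda>v. g (y # v))) (g (l x y # ys))"

definition sym_fun :: "('n list \<Rightarrow> 'n) \<Rightarrow> bool" where
  "sym_fun g \<longleftrightarrow> (\<forall>u x y v. g (u @ x # y # v) = g (u @ y # x # v))"

lemma lie_closed [simp]: "lie x ys g \<in> C" by (cases ys) simp_all
lemma lie_p: "lie x ys (\<lambda>v. p (g v) (h v)) = p (lie x ys g) (lie x ys h)"
  by (induction ys arbitrary: g h) (simp_all add: l_p grp)
lemma lie_mi: "lie x ys (\<lambda>v. mi (g v) (h v)) = mi (lie x ys g) (lie x ys h)"
  by (induction ys arbitrary: g h) (simp_all add: l_mi grp)
lemma lie_z [simp]: "lie x ys (\<lambda>v. z) = z"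
  by (induction ys) simp_all
lemma lie_sc:
  "c \<in> carrier K \<Longrightarrow> lie x ys (\<lambda>v. sc c (g v)) = sc c (lie x ys g)"
  by (induction ys arbitrary: g) (simp_all add: l_sc sc_mi)

lemma sym_fun_Cons: "sym_fun g \<Longrightarrow> sym_fun (\<lambda>v. g (a # v))"
  unfolding sym_fun_def by (metis append_Cons)
lemma sym_funD: "sym_fun g \<Longrightarrow> g (x # y # v) = g (y # x # v)"
  unfolding sym_fun_def by (metis append_Nil)

lemma lie_sym_fun: "sym_fun g \<Longrightarrow> sym_fun (\<lambda>v. lie x v g)"
proof -
  have "lie x (u @ a # b # v) g = lie x (u @ b # a # v) g" if "sym_fun g" for u a b v
    using that
  proof (induction u arbitrary: g)
    case Nil
    have "(\<lambda>w. g (a # b # w)) = (\<lambda>w. g (b # a # w))" using sym_funD[OF Nil] by auto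
    then show ?case using sym_funD[OF Nil, of a "l x b"] sym_funD[OF Nil, of "l x a" b] by (simp add: grp)
  next
    case (Cons w u)
    have e: "g (w' # u @ a # b # v) = g (w' # u @ b # a # v)" for w'
      using Cons.prems unfolding sym_fun_def by (metis append_Cons)
    show ?case using Cons.IH[OF sym_fun_Cons[OF Cons.prems]] by (simp add: e)
  qed
  then show "sym_fun g \<Longrightarrow> sym_fun (\<lambda>v. lie x v g)" by (auto simp: sym_fun_def)
qed

text \<open>This is x (b' g)' = b' x g' + x b'' g, with x b'' expressed by the available operators
  as (x |- b)' - x' b'. An insertion contributes the same term to both sides, which leaves the empty
  list, where the identity is left symmetry for -| together with a 0-identity.\<close>

lemma lie_r:
  "p (lie x ys (\<lambda>v. r (g v) b)) (r (r (g ys) x) b) = p (r (lie x ys g) b) (r (g ys) (l x b))"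
proof (induction ys arbitrary: g)
  case Nil
  then show ?case using lsym_r[of "g []" x b] by (simp add: r_l p_ac)
next
  case (Cons y ys)
  show ?case using Cons.IH[of "\<lambda>v. g (y # v)"] by (simp add: mi_r grp)
qed

text \<open>In the last condition, x |- b is x b' and x -| b is b' x. In front of further factors
  they agree, and b' can be moved to the very front, where it acts as \<open>r _ b\<close>.
  Linearity in the later arguments follows by symmetry.\<close>

definition multi0 :: "('n list \<Rightarrow> 'n) \<Rightarrow> bool" where
  "multi0 g \<longleftrightarrow> (\<forall>u. g u \<in> C) \<and> sym_fun g \<and>
    (\<forall>x y u. g (p x y # u) = p (g (x # u)) (g (y # u))) \<and>
    (\<forall>c x u. c \<in> carrier K \<longrightarrow> g (sc c x # u) = sc c (g (x # u))) \<and>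
    (\<forall>x b u. g (l x b # u) = r (g (x # u)) b \<and> g (r x b # u) = r (g (x # u)) b)"

lemma multi0D:
  assumes "multi0 g"
  shows "g u \<in> C" "sym_fun g" "g (p x y # u) = p (g (x # u)) (g (y # u))"
    "c \<in> carrier K \<Longrightarrow> g (sc c x # u) = sc c (g (x # u))"
    "g (l x b # u) = r (g (x # u)) b" "g (r x b # u) = r (g (x # u)) b"
  using assms by (auto simp: multi0_def)

lemma multi0_Cons: assumes "multi0 g" shows "multi0 (\<lambda>v. g (a # v))"
proof -
  have e: "g (a # x # u) = g (x # a # u)" for x u by (rule sym_funD) (rule multi0D[OF assms])
  show ?thesis unfolding multi0_def
    by (simp only: e) (use multi0D[OF assms] sym_fun_Cons[of g a] in \<open>auto simp: e\<close>)
qed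

text \<open>Right commutativity in the form \<open>l (l x b) y = r (l x y) b\<close> moves b' to the
  front of (x b') g', at the empty list and at every insertion.\<close>

lemma lie_l: "multi0 g \<Longrightarrow> lie (l x b) ys g = r (lie x ys g) b"
proof (induction ys arbitrary: g)
  case Nil then show ?case by (simp add: rcomm_l)
next
  case (Cons y ys)
  have "g (l (l x b) y # ys) = r (g (l x y # ys)) b"
    using multi0D(6)[OF Cons.prems, of "l x y" b ys] by (simp add: rcomm_l)
  then show ?case using Cons.IH[OF multi0_Cons[OF Cons.prems]] by (simp add: mi_r)
qed

lemma lie_rl: "lie (r x b) ys g = lie (l x b) ys g"
  by (induction ys arbitrary: g) (simp_all add: l_r)

lemma lie_add: "multi0 g \<Longrightarrow> lie (p x y) ys g = p (lie x ys g) (lie y ys g)"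
  by (induction ys arbitrary: g) (simp_all add: p_l multi0_Cons multi0D grp)

lemma lie_sc1:
  "c \<in> carrier K \<Longrightarrow> multi0 g \<Longrightarrow> lie (sc c x) ys g = sc c (lie x ys g)"
  by (induction ys arbitrary: g) (simp_all add: sc_l multi0_Cons multi0D sc_mi)

text \<open>Since x (y g')' = x y' g' + x y g'', the term x y g'' is (x d)(y d) g minus ((x |- y) d)
  g, and it has to be symmetric in x and y. At the empty list and at each inserted argument this is
  left symmetry for |-.\<close>

lemma lie_lie:
  "multi0 g \<Longrightarrow> p (lie x ys (\<lambda>v. lie y v g)) (lie (l y x) ys g) = p (lie y ys (\<lambda>v. lie x v g)) (lie (l x y) ys g)"
proof (induction ys arbitrary: g)
  case Nil
  then show ?case using lsym_l[of x y "g []"] by (simp add: p_ac)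
next
  case (Cons w ys)
  have 1: "p (g (l (l x y) w # ys)) (g (l y (l x w) # ys)) = p (g (l (l y x) w # ys)) (g (l x (l y w) # ys))"
    using multi0D(3)[OF Cons.prems, symmetric] by (simp add: lsym_l)
  have 2: "lie x ys (\<lambda>v. lie y (w # v) g) = mi (lie x ys (\<lambda>v. lie y v (\<lambda>v. g (w # v)))) (lie x ys (\<lambda>v. g (l y w # v)))" for x y
    by (simp add: lie_mi)
  have 3: "lie x (w # ys) (\<lambda>v. lie y v g) =
     mi (mi (lie x ys (\<lambda>v. lie y v (\<lambda>v. g (w # v)))) (lie x ys (\<lambda>v. g (l y w # v))))
       (mi (lie y ys (\<lambda>v. g (l x w # v))) (g (l y (l x w) # ys)))" for x y
    by (simp add: lie_mi)
  define X where "X = lie x ys (\<lambda>v. lie y v (\<lambda>v. g (w # v)))"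
  define Y where "Y = lie y ys (\<lambda>v. lie x v (\<lambda>v. g (w # v)))"
  define X1 where "X1 = lie (l y x) ys (\<lambda>v. g (w # v))"
  define Y1 where "Y1 = lie (l x y) ys (\<lambda>v. g (w # v))"
  have IH: "p X X1 = p Y Y1" using Cons.IH[OF multi0_Cons[OF Cons.prems]] by (simp add: X_def Y_def X1_def Y1_def)
  show ?case unfolding 3 lie.simps(2)[of "l y x"] lie.simps(2)[of "l x y"]
    unfolding X_def[symmetric] Y_def[symmetric] X1_def[symmetric] Y1_def[symmetric]
    using arg_cong[OF arg_cong2[where f = p, OF IH 1], of "\<lambda>t. p t (p (lie x ys (\<lambda>v. g (l y w # v)))
      (lie y ys (\<lambda>v. g (l x w # v))))"]
    by (simp add: grp)
qed

lemma sym_funI: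
  assumes "\<And>x. sym_fun (\<lambda>v. h (x # v))" "\<And>x y v. h (x # y # v) = h (y # x # v)"
  shows "sym_fun h"
  unfolding sym_fun_def
proof (intro allI)
  fix u x y v
  show "h (u @ x # y # v) = h (u @ y # x # v)"
    using assms by (cases u) (auto simp: sym_fun_def)
qed

text \<open>
  The list \<open>a # xs\<close> pairs \<open>g\<close> with $a \cdot xs$, so $g'$ takes the value of $a\,g'$ at \<open>xs\<close>.
\<close>

definition total_der :: "('n list \<Rightarrow> 'n) \<Rightarrow> 'n list \<Rightarrow> 'n" where
  "total_der g xs = (case xs of [] \<Rightarrow> z | x # ys \<Rightarrow> lie x ys g)"
text \<open>Multiplication by b', which keeps the weight; \<open>plug a\<close> is multiplication by
  a, which lowers it by one.\<close>

definition rmul :: "'n \<Rightarrow> ('n list \<Rightarrow> 'n) \<Rightarrow> 'n list \<Rightarrow> 'n" where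
  "rmul b g xs = r (g xs) b"
definition plug :: "'n \<Rightarrow> ('n list \<Rightarrow> 'n) \<Rightarrow> 'n list \<Rightarrow> 'n" where
  "plug a g xs = g (a # xs)"

text \<open>Symmetry of the derivative is not automatic, but once imposed it is inherited by all derivatives.\<close>

definition multi :: "('n list \<Rightarrow> 'n) \<Rightarrow> bool" where
  "multi g \<longleftrightarrow> multi0 g \<and> sym_fun (total_der g)"

lemma multi_multi0: "multi g \<Longrightarrow> multi0 g" by (simp add: multi_def)
lemma multi_closed: "multi g \<Longrightarrow> g u \<in> C" by (simp add: multi_def multi0_def)

text \<open>A derivative has weight at least 0 and so no part of weight -1, whence the value
  \<open>z\<close> at the empty list.\<close>

lemma total_der_simps [simp]:
  "total_der g [] = z" "total_der g (x # ys) = lie x ys g" by (simp_all add: total_der_def)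
lemma total_der_closed [simp]: "total_der g xs \<in> C" by (cases xs) simp_all
lemma total_der_p:
  "total_der (\<lambda>v. p (g v) (h v)) xs = p (total_der g xs) (total_der h xs)" by (cases xs) (simp_all add: lie_p)
lemma total_der_mi:
  "total_der (\<lambda>v. mi (g v) (h v)) xs = mi (total_der g xs) (total_der h xs)" by (cases xs) (simp_all add: lie_mi)
lemma total_der_sc:
  "c \<in> carrier K \<Longrightarrow> total_der (\<lambda>v. sc c (g v)) xs = sc c (total_der g xs)" by (cases xs) (simp_all add: lie_sc)
lemma total_der_leibniz:
  "total_der (\<lambda>xs. leibniz n (\<lambda>k j. G k j xs) k j) xs = leibniz n (\<lambda>k j. total_der (G k j) xs) k j"
  by (induction n arbitrary: k j) (simp_all add: total_der_p)

lemma multi_total_der: assumes "multi g" shows "multi (total_der g)"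
proof -
  have multi0: "multi0 g" "sym_fun (total_der g)" using assms by (auto simp: multi_def)
  have "multi0 (total_der g)"
    unfolding multi0_def using multi0 by (auto simp: lie_add lie_sc1 lie_l lie_rl)
  moreover have "sym_fun (total_der (total_der g))"
  proof (rule sym_funI)
    show "sym_fun (\<lambda>v. total_der (total_der g) (x # v))" for x using lie_sym_fun[OF multi0(2)] by simp
    show "total_der (total_der g) (x # y # v) = total_der (total_der g) (y # x # v)" for x y v
      using lie_lie[OF multi0(1), of x v y] by (simp add: grp)
  qed
  ultimately show ?thesis by (simp add: multi_def)
qed

lemma lie_rmul:
  "lie x ys (rmul b g) = mi (p (r (lie x ys g) b) (r (g ys) (l x b))) (r (r (g ys) x) b)"
  using lie_r[of x ys g b] by (simp add: rmul_def[abs_def] grp)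

lemma multi0_rmul: "multi0 g \<Longrightarrow> multi0 (rmul b g)"
  unfolding multi0_def rmul_def by (auto simp: p_r sc_r sym_fun_def intro: rcomm_r)

lemma multi_rmul: assumes "multi g" shows "multi (rmul b g)"
proof -
  have multi0: "multi0 g" "sym_fun (total_der g)" using assms by (auto simp: multi_def)
  have "sym_fun (total_der (rmul b g))"
  proof (rule sym_funI)
    show "sym_fun (\<lambda>v. total_der (rmul b g) (x # v))" for x using lie_sym_fun[OF multi0D(2)[OF multi0_rmul[OF multi0(1)]]] by simp
    show "total_der (rmul b g) (x # y # v) = total_der (rmul b g) (y # x # v)" for x y v
    proof -
      \<comment> \<open>These are the two terms of x y b'' g. Their difference is minus the
        associator of y, x, b, inserted into g, and left symmetry makes it symmetric in x and
        y.\<close>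
      have 1: "r (g (y # v)) (l x b) = g (l y (l x b) # v)" "r (r (g (y # v)) x) b = g (l (l y x) b # v)" for x y
        by (simp_all add: multi0D(5)[OF multi0(1)])
      have 2: "p (g (l (l x y) b # v)) (g (l y (l x b) # v)) = p (g (l (l y x) b # v)) (g (l x (l y b) # v))"
        using multi0D(3)[OF multi0(1), symmetric] by (simp add: lsym_l)
      have 3: "lie x (y # v) g = lie y (x # v) g" using sym_funD[OF multi0(2)] by simp
      show ?thesis unfolding total_der_simps lie_rmul 1 3
        using arg_cong[OF 2, of "p (r (lie y (x # v) g) b)"] by (simp add: grp del: lie.simps)
    qed
  qed
  then show ?thesis using multi0_rmul[OF multi0(1)] by (simp add: multi_def)
qed

lemma total_der_plug_Cons:
  "multi0 g \<Longrightarrow> total_der (plug a g) (x # v) = p (total_der g (x # a # v)) (r (g (x # v)) a)"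
  by (simp add: plug_def[abs_def] grp multi0D)

lemma multi_plug: assumes "multi g" shows "multi (plug a g)"
proof -
  have multi0: "multi0 g" "sym_fun (total_der g)" using assms by (auto simp: multi_def)
  note s1 = multi0(2)[unfolded sym_fun_def, rule_format]
  note s2 = multi0D(2)[OF multi0(1), unfolded sym_fun_def, rule_format]
  have "sym_fun (total_der (plug a g))"
  proof (rule sym_funI)
    fix x
    show "sym_fun (\<lambda>v. total_der (plug a g) (x # v))"
      unfolding total_der_plug_Cons[OF multi0(1)] sym_fun_def
      using s1[of "x # a # _"] s2[of "x # _"] by (simp del: total_der_simps)
    show "total_der (plug a g) (x # y # v) = total_der (plug a g) (y # x # v)" for y v
      unfolding total_der_plug_Cons[OF multi0(1)]
      using s1[of "[x]" a y v] s1[of "[]" x y "a # v"] s1[of "[y]" x a v] s2[of "[]" x y v] by (simp del: total_der_simps)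
  qed
  then show ?thesis using multi0_Cons[OF multi0(1), of a] by (simp add: multi_def plug_def[abs_def])
qed

text \<open>The product rule (a g)' = a g' + a' g is the insertion rule of \<open>lie\<close> read
  backwards, up to the order of the first two arguments. At the empty list the left side is zero,
  since insertion forgets the value \<open>g []\<close>; hence the assumption on it.\<close>

lemma total_der_plug:
  "multi g \<Longrightarrow> g [] = z \<Longrightarrow> total_der (plug a g) xs = p (total_der g (a # xs)) (r (g xs) a)"
proof (cases xs)
  case (Cons x v)
  assume multi: "multi g"
  then have "total_der g (x # a # v) = total_der g (a # x # v)" by (intro sym_funD) (simp add: multi_def)
  then show ?thesis using total_der_plug_Cons[OF multi_multi0[OF multi]] Cons by (simp del: total_der_simps)
qed simp

lemma sym_fun_p:
  "sym_fun g \<Longrightarrow> sym_fun h \<Longrightarrow> sym_fun (\<lambda>v. f (g v) (h v))" by (simp add: sym_fun_def)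

lemma multi_mi:
  "multi g \<Longrightarrow> multi h \<Longrightarrow> multi (\<lambda>v. mi (g v) (h v))"
  unfolding multi_def multi0_def by (auto simp: sym_fun_p total_der_mi[abs_def] grp sc_mi mi_r)

text \<open>Multiplication by $a^{(k+1)}$ is the \<open>k\<close>-fold commutator of the derivation with multiplication by $a'$.\<close>

primrec rmul_der :: "'n \<Rightarrow> nat \<Rightarrow> ('n list \<Rightarrow> 'n) \<Rightarrow> 'n list \<Rightarrow> 'n" where
  "rmul_der a 0 g = rmul a g"
| "rmul_der a (Suc k) g = (\<lambda>xs. mi (total_der (rmul_der a k g) xs) (rmul_der a k (total_der g) xs))"

text \<open>Multiplication by a^(k), with the order shifted by one against
  \<open>rmul_der\<close>.\<close>

definition letter :: "'n \<Rightarrow> nat \<Rightarrow> ('n list \<Rightarrow> 'n) \<Rightarrow> 'n list \<Rightarrow> 'n" where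
  "letter a k = (case k of 0 \<Rightarrow> plug a | Suc k \<Rightarrow> rmul_der a k)"

lemma letter_simps [simp]:
  "letter a 0 = plug a" "letter a (Suc k) = rmul_der a k" by (simp_all add: letter_def)

lemma multi_rmul_der: "multi g \<Longrightarrow> multi (rmul_der a k g)"
  by (induction k arbitrary: g) (simp_all add: multi_rmul multi_mi multi_total_der)
lemma multi_letter: "multi g \<Longrightarrow> multi (letter a k g)"
  by (cases k) (simp_all add: multi_rmul_der multi_plug)

lemma rmul_der_closed [simp]: "rmul_der a k g xs \<in> C"
  by (cases k) (simp_all add: rmul_def)

lemma rmul_der_p:
  "rmul_der a k (\<lambda>v. p (g v) (h v)) = (\<lambda>v. p (rmul_der a k g v) (rmul_der a k h v))"
  by (induction k arbitrary: g h) (simp_all add: rmul_def[abs_def] p_r total_der_p total_der_p[abs_def] grp)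
lemma rmul_der_mi:
  "rmul_der a k (\<lambda>v. mi (g v) (h v)) = (\<lambda>v. mi (rmul_der a k g v) (rmul_der a k h v))"
  by (induction k arbitrary: g h) (simp_all add: rmul_def[abs_def] mi_r total_der_mi total_der_mi[abs_def] grp)
lemma p_rmul_der: "rmul_der (p a b) k g = (\<lambda>v. p (rmul_der a k g v) (rmul_der b k g v))"
  by (induction k arbitrary: g) (simp_all add: rmul_def[abs_def] r_p total_der_p grp)
lemma sc_rmul_der:
  "c \<in> carrier K \<Longrightarrow> rmul_der (sc c a) k g = (\<lambda>v. sc c (rmul_der a k g v))"
  by (induction k arbitrary: g) (simp_all add: rmul_def[abs_def] r_sc total_der_sc sc_mi)

lemma rmul_der_Nil: "h [] = z \<Longrightarrow> rmul_der b k h [] = z"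
  by (induction k arbitrary: h) (simp_all add: rmul_def)
text \<open>Multiplication by b^(k+2) raises the weight, so no part of weight -1 remains, whatever
  \<open>h\<close> is.\<close>

lemma rmul_der_Suc_Nil [simp]: "rmul_der b (Suc k) h [] = z"
  by (simp add: rmul_der_Nil)

lemma total_der_rmul_der:
  "total_der (rmul_der a k g) = (\<lambda>xs. p (rmul_der a (Suc k) g xs) (rmul_der a k (total_der g) xs))"
  by (simp add: grp fun_eq_iff)

lemma total_der_letter:
  "multi g \<Longrightarrow> 0 < k \<or> g [] = z \<Longrightarrow> total_der (letter a k g) xs = p (letter a (Suc k) g xs) (letter a k (total_der g) xs)"
  by (cases k) (auto simp: total_der_plug total_der_rmul_der rmul_def p_ac plug_def simp del: rmul_der.simps(2))

lemma letter_p: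
  "letter a k (\<lambda>v. p (g v) (h v)) = (\<lambda>v. p (letter a k g v) (letter a k h v))"
  by (cases k) (simp_all add: rmul_der_p plug_def[abs_def])

text \<open>An outer letter of order 0 obeys the product rule only if the inner product has no part
  of weight -1, which an inner letter of order at least 2 guarantees.\<close>

lemma total_der_letter_letter:
  assumes "multi g" "0 < j" "0 < k \<or> 1 < j"
  shows "total_der (letter a k (letter b j g)) xs =
    p (p (letter a (Suc k) (letter b j g) xs) (letter a k (letter b (Suc j) g) xs)) (letter a k (letter b j (total_der g)) xs)"
proof -
  obtain j' where j: "j = Suc j'" using assms(2) by (cases j) auto
  have "total_der (letter a k (letter b j g)) xs = p (letter a (Suc k) (letter b j g) xs) (letter a k (total_der (letter b j g)) xs)"
    by (rule total_der_letter[OF multi_letter[OF assms(1)]]) (use assms(3) j in \<open>cases j'; auto simp del: rmul_der.simps(2)\<close>)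
  also have "total_der (letter b j g) = (\<lambda>v. p (letter b (Suc j) g v) (letter b j (total_der g) v))"
    by (simp add: j total_der_rmul_der del: rmul_der.simps)
  finally show ?thesis by (simp add: letter_p p_ac)
qed

lemma letter_l:
  "multi g \<Longrightarrow> letter (l a b) n g xs = leibniz n (\<lambda>k j. letter a k (letter b j g) xs) 0 1"
proof (induction n arbitrary: g xs)
  case 0
  then show ?case by (simp add: plug_def rmul_def multi_multi0 multi0D)
next
  case (Suc n)
  show ?case
  proof (cases n)
    case 0
    \<comment> \<open>The letter of order 1 is \<open>rmul\<close>, not a commutator, so (a b')' =
      a' b' + a b'' is read off from \<open>lie_rmul\<close>.\<close>
    have "lie a xs (rmul b g) = mi (p (r (lie a xs g) b) (r (g xs) (l a b))) (r (r (g xs) a) b)"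
      by (rule lie_rmul)
    then show ?thesis using 0 rcomm_r[of "g xs" a b] by (simp add: plug_def rmul_def grp)
  next
    case (Suc m)
    let ?G = "\<lambda>g xs k j. letter a k (letter b j g) xs"
    have "letter (l a b) (Suc n) g xs = mi (total_der (letter (l a b) n g) xs) (letter (l a b) n (total_der g) xs)"
      by (simp add: Suc)
    also have "letter (l a b) n g = (\<lambda>xs. leibniz n (?G g xs) 0 1)"
      using Suc.IH[OF Suc.prems] by (simp add: fun_eq_iff)
    also have "total_der (\<lambda>xs. leibniz n (?G g xs) 0 1) xs = leibniz n (\<lambda>k j. total_der (letter a k (letter b j g)) xs) 0 1"
      by (rule total_der_leibniz)
    \<comment> \<open>Here n > 0 and j starts at 1, so the entry with k = 0 has j = n + 1 > 1, as
      \<open>total_der_letter_letter\<close> demands.\<close>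
    also have "\<dots> = leibniz n (\<lambda>k j. p (p (?G g xs (Suc k) j) (?G g xs k (Suc j))) (?G (total_der g) xs k j)) 0 1"
      by (rule leibniz_cong, rule total_der_letter_letter) (use Suc Suc.prems in auto)
    also have "\<dots> = p (p (leibniz n (?G g xs) (Suc 0) 1) (leibniz n (?G g xs) 0 (Suc 1))) (leibniz n (?G (total_der g) xs) 0 1)"
      by (simp only: leibniz_p leibniz_shift[of n "?G g xs"] leibniz_shift'[of n "?G g xs"])
    also have "letter (l a b) n (total_der g) xs = leibniz n (?G (total_der g) xs) 0 1"
      by (rule Suc.IH[OF multi_total_der[OF Suc.prems]])
    finally show ?thesis by (simp only: leibniz.simps mi_cancel p_closed)
  qed
qed

text \<open>
  Since \<open>rmul_der a (Suc m) g\<close> vanishes at the empty list, it is determined by its insertions. In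
  the \<open>n\<close>-th derivative of $x \vdash a = x a'$, as given by \<open>letter_l\<close>, the insertion of \<open>x\<close> is the only
  term that is not built from derivatives of \<open>a\<close> of lower order.
\<close>

lemma rmul_rmul_der: "multi g \<Longrightarrow> rmul b (rmul_der a n g) = rmul_der a n (rmul b g)"
proof (induction n arbitrary: a g rule: less_induct)
  case (less n)
  show ?case
  proof (cases n)
    case 0
    then show ?thesis by (simp add: rmul_def fun_eq_iff rcomm_r)
  next
    case (Suc m)
    have IH: "r (rmul_der a i g xs) b = rmul_der a i (rmul b g) xs" if "i \<le> m" "multi g" for a i g xs
      using fun_cong[OF less.IH[of i g a], of xs] that Suc by (simp add: rmul_def[of _ "rmul_der a i g"])
    have "rmul b (rmul_der a n g) xs = rmul_der a n (rmul b g) xs" for xs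
    proof (cases xs)
      case Nil
      then show ?thesis using Suc by (simp add: rmul_def del: rmul_der.simps)
    next
      case (Cons x v)
      \<comment> \<open>\<open>?G k j\<close> is the commutator of b' with x^(k) a^(j). Summed by
        the Leibniz rule, these give the commutator with (x |- a)^(n), which is zero by induction
        because \<open>letter (l x a) n\<close> is \<open>rmul_der (l x a) m\<close> with m <
        n.\<close>
      let ?G = "\<lambda>k j. mi (r (letter x k (letter a j g) v) b) (letter x k (letter a j (rmul b g)) v)"
      have "leibniz n ?G 0 1 = mi (r (leibniz n (\<lambda>k j. letter x k (letter a j g) v) 0 1) b) (leibniz n (\<lambda>k j. letter x k (letter a j (rmul b g)) v) 0 1)"
        by (subst leibniz_hom[of "\<lambda>x. r x b"]) (simp_all add: p_r leibniz_mi)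
      also have "\<dots> = mi (r (letter (l x a) n g v) b) (letter (l x a) n (rmul b g) v)"
        using letter_l[OF less.prems] letter_l[OF multi_rmul[OF less.prems]] by simp
      also have "\<dots> = z"
        using IH[of m g] less.prems by (simp add: Suc)
      finally have "leibniz n ?G 0 1 = z" .
      moreover have "leibniz n ?G 0 1 = ?G 0 (1 + n)"
      proof (rule leibniz_single)
        fix i i' assume i: "i + i' = n" "0 < i"
        then obtain i1 where i1: "i = Suc i1" by (cases i) auto
        have "r (rmul_der x i1 (rmul_der a i' g) v) b = rmul_der x i1 (rmul b (rmul_der a i' g)) v"
          by (rule IH) (use i i1 Suc less.prems in \<open>auto intro: multi_rmul_der\<close>)
        also have "rmul b (rmul_der a i' g) = rmul_der a i' (rmul b g)"
          using IH[of i' g] i i1 Suc less.prems by (auto simp: rmul_def fun_eq_iff)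
        finally show "?G (0 + i) (1 + i') = z" by (simp add: i1)
      qed simp
      ultimately have "mi (r (rmul_der a n g (x # v)) b) (rmul_der a n (rmul b g) (x # v)) = z"
        by (simp add: plug_def)
      then show ?thesis by (simp add: Cons rmul_def mi_eq)
    qed
    then show ?thesis by blast
  qed
qed

text \<open>A commutator with the derivation passes from a^(j+1) to a^(j+2). It also brings in a
  further derivative of b, so k has to vary in the induction.\<close>

lemma rmul_der_rmul_der:
  "multi g \<Longrightarrow> rmul_der a j (rmul_der b k g) = rmul_der b k (rmul_der a j g)"
proof (induction j arbitrary: k g)
  case 0
  then show ?case by (simp add: rmul_rmul_der)
next
  case (Suc j)
  have "rmul_der a (Suc j) (rmul_der b k g) = (\<lambda>v. mi (total_der (rmul_der a j (rmul_der b k g)) v) (rmul_der a j (total_der (rmul_der b k g)) v))"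
    by simp
  also have "\<dots> = (\<lambda>v. mi (total_der (rmul_der b k (rmul_der a j g)) v) (p (rmul_der b (Suc k) (rmul_der a j g) v) (rmul_der b k (rmul_der a j (total_der g)) v)))"
    unfolding total_der_rmul_der[of b k g] rmul_der_p using Suc.IH Suc.prems multi_total_der by (simp del: rmul_der.simps)
  also have "\<dots> = rmul_der b k (rmul_der a (Suc j) g)"
    by (simp add: total_der_rmul_der[of b k "rmul_der a j g"] rmul_der_mi grp fun_eq_iff del: rmul_der.simps(2)) (simp add: rmul_der_mi grp)
  finally show ?case .
qed

text \<open>Pulling the derivation past the insertion of x yields x' b^(n+1) g twice, with opposite
  signs and the two factors in either order; \<open>rmul_rmul_der\<close> cancels them.\<close>

lemma plug_rmul_der:
  "multi g \<Longrightarrow> g [] = z \<Longrightarrow> plug x (rmul_der b n g) = rmul_der b n (plug x g)"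
proof (induction n arbitrary: g)
  case 0
  then show ?case by (simp add: plug_def rmul_def fun_eq_iff)
next
  case (Suc n)
  have c: "total_der (plug x g) = (\<lambda>v. p (plug x (total_der g) v) (rmul x g v))" if "multi g" "g [] = z" for g
    using total_der_plug[OF that] by (simp add: plug_def rmul_def fun_eq_iff)
  have e1: "total_der (rmul_der b n (plug x g)) = (\<lambda>v. p (plug x (total_der (rmul_der b n g)) v) (rmul x (rmul_der b n g) v))"
    using c[OF multi_rmul_der[OF Suc.prems(1), of b n], OF rmul_der_Nil, OF Suc.prems(2)] Suc by simp
  have e2: "rmul_der b n (total_der (plug x g)) = (\<lambda>v. p (plug x (rmul_der b n (total_der g)) v) (rmul_der b n (rmul x g) v))"
    using Suc by (simp add: c rmul_der_p Suc.IH multi_total_der)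
  show ?case
    by (simp add: e1 e2 rmul_rmul_der[OF Suc.prems(1), symmetric] grp fun_eq_iff) (simp add: plug_def grp)
qed

section \<open>Elements of the dialgebra as multilinear maps\<close>

definition const0 :: "'n \<Rightarrow> 'n list \<Rightarrow> 'n" where
  "const0 y xs = (if xs = [] then y else z)"

text \<open>An element of the dialgebra has weight -1 and so is visible at the empty list only. Its
  derivative lives on lists of length one, where it sends x to \<open>l x y\<close>, so its symmetry
  is trivial.\<close>

lemma multi_const0: assumes "y \<in> C" shows "multi (const0 y)"
proof -
  have "lie x (w # v) (const0 y) = z" for x w v by (simp add: const0_def)
  then have *: "total_der (const0 y) (x # w # v) = z" for x w v by (simp del: lie.simps)
  have "total_der (const0 y) (u @ a # b # v) = z" for u a b v
  proof (cases u)
    case (Cons c u')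
    then show ?thesis using *[of c] by (cases u') (simp_all del: total_der_simps)
  qed (simp add: * del: total_der_simps)
  then have "sym_fun (total_der (const0 y))" by (simp add: sym_fun_def)
  then show ?thesis using assms by (auto simp: multi_def multi0_def const0_def sym_fun_def)
qed

lemma const0_l: "const0 (l a b) = plug a (total_der (const0 b))"
proof
  show "const0 (l a b) xs = plug a (total_der (const0 b)) xs" for xs by (cases xs) (simp_all add: plug_def const0_def)
qed

lemma multi_total_der_pow: "multi g \<Longrightarrow> multi ((total_der ^^ n) g)"
  by (induction n) (simp_all add: multi_total_der)

text \<open>The Leibniz rule for (a b')^(n). As j starts at 1, each letter acts on a derivative,
  whose value at the empty list is zero, so the product rule is available for insertion too.\<close>

lemma total_der_pow_const0_l:
  "b \<in> C \<Longrightarrow> (total_der ^^ n) (const0 (l a b)) xs = leibniz n (\<lambda>k j. letter a k ((total_der ^^ j) (const0 b)) xs) 0 1"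
proof (induction n arbitrary: xs)
  case 0
  then show ?case by (simp add: const0_l)
next
  case (Suc n)
  let ?G = "\<lambda>xs k j. letter a k ((total_der ^^ j) (const0 b)) xs"
  have "(total_der ^^ n) (const0 (l a b)) = (\<lambda>xs. leibniz n (?G xs) 0 1)"
    using Suc.IH[OF Suc.prems] by (rule ext)
  then have "(total_der ^^ Suc n) (const0 (l a b)) xs = total_der (\<lambda>xs. leibniz n (?G xs) 0 1) xs" by simp
  also have "\<dots> = leibniz n (\<lambda>k j. total_der (letter a k ((total_der ^^ j) (const0 b))) xs) 0 1" by (rule total_der_leibniz)
  also have "\<dots> = leibniz n (\<lambda>k j. p (?G xs (Suc k) j) (?G xs k (Suc j))) 0 1"
  proof (rule leibniz_cong)
    fix i i'
    show "total_der (letter a (0 + i) ((total_der ^^ (1 + i')) (const0 b))) xs =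
      p (?G xs (Suc (0 + i)) (1 + i')) (?G xs (0 + i) (Suc (1 + i')))"
      by (subst total_der_letter) (use Suc.prems in \<open>simp_all add: multi_total_der multi_total_der_pow multi_const0\<close>)
  qed
  also have "\<dots> = leibniz (Suc n) (?G xs) 0 1"
    by (simp only: leibniz_p leibniz_shift[of n "?G xs"] leibniz_shift'[of n "?G xs"] leibniz.simps)
  finally show ?case .
qed

lemma total_der_sc':
  "c \<in> carrier K \<Longrightarrow> total_der (\<lambda>v. sc c (g v)) = (\<lambda>xs. sc c (total_der g xs))"
  by (rule ext) (rule total_der_sc)

lemma rmul_der_sc:
  "c \<in> carrier K \<Longrightarrow> rmul_der a k (\<lambda>v. sc c (g v)) = (\<lambda>v. sc c (rmul_der a k g v))"
  by (induction k arbitrary: g) (simp_all add: rmul_def[abs_def] sc_r total_der_sc' sc_mi)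

section \<open>Functions of words\<close>

text \<open>
  A letter \<open>(a, k)\<close> stands for $a^{(k)}$. Insertion annihilates weight $-1$ here, although multiplication by
  $a$ does not, so in evaluating a word the letters of positive order have to act first.
\<close>

primrec apply_pos :: "('n \<times> nat) list \<Rightarrow> ('n list \<Rightarrow> 'n) \<Rightarrow> 'n list \<Rightarrow> 'n" where
  "apply_pos [] g = g"
| "apply_pos (c # u) g = (case snd c of 0 \<Rightarrow> apply_pos u g | Suc k \<Rightarrow> rmul_der (fst c) k (apply_pos u g))"

primrec plain :: "('n \<times> nat) list \<Rightarrow> 'n list" where
  "plain [] = []"
| "plain (c # u) = (case snd c of 0 \<Rightarrow> fst c # plain u | Suc k \<Rightarrow> plain u)"

text \<open>The part of weight -1 of the product of the word u with g.\<close>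

definition Phi :: "('n list \<Rightarrow> 'n) \<Rightarrow> ('n \<times> nat) list \<Rightarrow> 'n" where
  "Phi g u = apply_pos u g (plain u)"

lemma multi_apply_pos: "multi g \<Longrightarrow> multi (apply_pos u g)"
  by (induction u) (simp_all add: multi_rmul_der split: nat.split)

lemma apply_pos_Nil: "g [] = z \<Longrightarrow> apply_pos u g [] = z"
  by (induction u) (simp_all add: rmul_der_Nil split: nat.split)

lemma apply_pos_rmul_der:
  "multi g \<Longrightarrow> apply_pos u (rmul_der a k g) = rmul_der a k (apply_pos u g)"
  by (induction u) (auto simp: rmul_der_rmul_der multi_apply_pos split: nat.split)

lemma apply_pos_plug:
  "multi g \<Longrightarrow> g [] = z \<Longrightarrow> apply_pos u (plug a g) = plug a (apply_pos u g)"
  by (induction u) (auto simp: plug_rmul_der multi_apply_pos apply_pos_Nil split: nat.split)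

lemma apply_pos_p:
  "apply_pos u (\<lambda>v. p (g v) (h v)) = (\<lambda>v. p (apply_pos u g v) (apply_pos u h v))"
  by (induction u) (auto simp: rmul_der_p split: nat.split)
lemma apply_pos_sc:
  "c \<in> carrier K \<Longrightarrow> apply_pos u (\<lambda>v. sc c (g v)) = (\<lambda>v. sc c (apply_pos u g v))"
  by (induction u) (auto simp: rmul_der_sc split: nat.split)

lemma Phi_p: "Phi (\<lambda>v. p (g v) (h v)) u = p (Phi g u) (Phi h u)"
  by (simp add: Phi_def apply_pos_p)
lemma Phi_sc: "c \<in> carrier K \<Longrightarrow> Phi (\<lambda>v. sc c (g v)) u = sc c (Phi g u)"
  by (simp add: Phi_def apply_pos_sc)
lemma Phi_leibniz:
  "Phi (\<lambda>xs. leibniz n (\<lambda>k j. G k j xs) k j) u = leibniz n (\<lambda>k j. Phi (G k j) u) k j"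
  by (induction n arbitrary: k j) (simp_all add: Phi_p)

lemma Phi_Cons: "Phi g ((a, k) # u) = letter a k (apply_pos u g) (plain u)"
  by (cases k) (simp_all add: Phi_def plug_def)

text \<open>For a letter of order 0, an insertion has to be moved past the letters of positive
  order, which needs \<open>g [] = z\<close>.\<close>

lemma Phi_letter:
  "multi g \<Longrightarrow> 0 < k \<or> g [] = z \<Longrightarrow> Phi (letter a k g) u = Phi g ((a, k) # u)"
  by (cases k) (auto simp: Phi_Cons Phi_def[of "rmul_der _ _ _"] Phi_def[of "plug _ _"] apply_pos_rmul_der apply_pos_plug)

lemma apply_pos_swap:
  "multi g \<Longrightarrow> apply_pos (u @ x # y # v) g = apply_pos (u @ y # x # v) g"
proof (induction u)
  case Nil
  then show ?case by (auto simp: rmul_der_rmul_der multi_apply_pos split: nat.split)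
next
  case (Cons c u)
  from Cons.IH[OF Cons.prems] show ?case by (simp only: append_Cons apply_pos.simps)
qed

lemma plain_append: "plain (u @ v) = plain u @ plain v"
  by (induction u) (simp_all split: nat.split)

lemma Phi_swap: assumes "multi g" shows "Phi g (u @ x # y # v) = Phi g (u @ y # x # v)"
proof -
  have "sym_fun (apply_pos (u @ y # x # v) g)" using multi_apply_pos[OF assms] multi_multi0 multi0D(2) by blast
  then show ?thesis
    unfolding Phi_def apply_pos_swap[OF assms, of u x y]
    by (cases "snd x"; cases "snd y") (simp_all add: plain_append sym_fun_def del: apply_pos.simps)
qed

text \<open>The values on words of a linear map into \<open>C\<close> from the polynomial algebra in
  the letters a^(k), modulo linearity of a^(k) in a and the Leibniz expansion of (a b')^(n). As the
  tail \<open>u\<close> is arbitrary, a whole ideal of relations is respected.\<close>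

definition word_fun :: "(('n \<times> nat) list \<Rightarrow> 'n) \<Rightarrow> bool" where
  "word_fun w \<longleftrightarrow> (\<forall>u. w u \<in> C) \<and> (\<forall>u x y v. w (u @ x # y # v) = w (u @ y # x # v)) \<and>
    (\<forall>a b k u. w ((p a b, k) # u) = p (w ((a, k) # u)) (w ((b, k) # u))) \<and>
    (\<forall>c a k u. c \<in> carrier K \<longrightarrow> w ((sc c a, k) # u) = sc c (w ((a, k) # u))) \<and>
    (\<forall>a b n u. w ((l a b, n) # u) = leibniz n (\<lambda>k j. w ((a, k) # (b, j) # u)) 0 1)"

lemma word_funD:
  assumes "word_fun w"
  shows "w u \<in> C" "w (u @ x # y # v) = w (u @ y # x # v)"
    "w ((p a b, k) # u) = p (w ((a, k) # u)) (w ((b, k) # u))"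
    "c \<in> carrier K \<Longrightarrow> w ((sc c a, k) # u) = sc c (w ((a, k) # u))"
    "w ((l a b, n) # u) = leibniz n (\<lambda>k j. w ((a, k) # (b, j) # u)) 0 1"
proof -
  note * = assms[unfolded word_fun_def]
  show "w u \<in> C" by (rule *[THEN conjunct1, rule_format])
  note * = *[THEN conjunct2]
  show "w (u @ x # y # v) = w (u @ y # x # v)" by (rule *[THEN conjunct1, rule_format])
  note * = *[THEN conjunct2]
  show "w ((p a b, k) # u) = p (w ((a, k) # u)) (w ((b, k) # u))"
    by (rule *[THEN conjunct1, rule_format])
  note * = *[THEN conjunct2]
  show "c \<in> carrier K \<Longrightarrow> w ((sc c a, k) # u) = sc c (w ((a, k) # u))"
    by (rule *[THEN conjunct1, rule_format])
  show "w ((l a b, n) # u) = leibniz n (\<lambda>k j. w ((a, k) # (b, j) # u)) 0 1"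
    by (rule *[THEN conjunct2, rule_format])
qed

lemma word_fun_swap: "word_fun w \<Longrightarrow> w (x # y # v) = w (y # x # v)"
  using word_funD(2)[of w "[]" x y v] by simp

lemma word_fun_Phi: assumes "multi g" shows "word_fun (Phi g)"
  unfolding word_fun_def
proof (intro conjI allI impI)
  show "Phi g u \<in> C" for u by (simp add: Phi_def multi_closed multi_apply_pos assms)
  show "Phi g (u @ x # y # v) = Phi g (u @ y # x # v)" for u x y v by (rule Phi_swap[OF assms])
  fix a b k u
  note multi0 = multi_multi0[OF multi_apply_pos[OF assms]]
  show "Phi g ((p a b, k) # u) = p (Phi g ((a, k) # u)) (Phi g ((b, k) # u))"
    by (cases k) (simp_all add: Phi_Cons p_rmul_der plug_def multi0D(3)[OF multi0])
  show "c \<in> carrier K \<Longrightarrow> Phi g ((sc c a, k) # u) = sc c (Phi g ((a, k) # u))" for c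
    by (cases k) (simp_all add: Phi_Cons sc_rmul_der plug_def multi0D(4)[OF multi0])
  have "Phi g ((l a b, k) # u) = leibniz k (\<lambda>k j. letter a k (letter b j (apply_pos u g)) (plain u)) 0 1"
    by (simp add: Phi_Cons letter_l multi_apply_pos assms)
  also have "\<dots> = leibniz k (\<lambda>k j. Phi g ((a, k) # (b, j) # u)) 0 1"
    by (rule leibniz_cong) (simp add: Phi_Cons)
  finally show "Phi g ((l a b, k) # u) = leibniz k (\<lambda>k j. Phi g ((a, k) # (b, j) # u)) 0 1" .
qed

text \<open>The interchange law with \<open>p\<close> lets \<open>f\<close> pass through
  \<open>leibniz\<close>; both \<open>p\<close> and \<open>mi\<close> satisfy it.\<close>

lemma word_fun_bin:
  assumes f: "\<And>x y. f x y \<in> C" "\<And>a b c d. f (p a b) (p c d) = p (f a c) (f b d)"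
      "\<And>c x y. c \<in> carrier K \<Longrightarrow> f (sc c x) (sc c y) = sc c (f x y)"
    and w: "word_fun v" "word_fun w"
  shows "word_fun (\<lambda>u. f (v u) (w u))"
  unfolding word_fun_def
proof (intro conjI allI impI)
  show "f (v u) (w u) \<in> C" for u by (rule f)
  show "f (v (u @ x # y # t)) (w (u @ x # y # t)) = f (v (u @ y # x # t)) (w (u @ y # x # t))" for u x y t
    by (simp only: word_funD(2)[OF w(1), of u x] word_funD(2)[OF w(2), of u x])
  fix a b k u
  show "f (v ((p a b, k) # u)) (w ((p a b, k) # u)) =
    p (f (v ((a, k) # u)) (w ((a, k) # u))) (f (v ((b, k) # u)) (w ((b, k) # u)))"
    by (simp only: word_funD(3)[OF w(1)] word_funD(3)[OF w(2)] f)
  show "d \<in> carrier K \<Longrightarrow> f (v ((sc d a, k) # u)) (w ((sc d a, k) # u)) =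
      sc d (f (v ((a, k) # u)) (w ((a, k) # u)))" for d
    by (simp only: word_funD(4)[OF w(1)] word_funD(4)[OF w(2)] f)
  have "leibniz n (\<lambda>k j. f (G k j) (H k j)) k j = f (leibniz n G k j) (leibniz n H k j)" for n G H k j
    by (induction n arbitrary: k j) (simp_all add: f)
  then show "f (v ((l a b, k) # u)) (w ((l a b, k) # u)) =
      leibniz k (\<lambda>k j. f (v ((a, k) # (b, j) # u)) (w ((a, k) # (b, j) # u))) 0 1"
    by (simp only: word_funD(5)[OF w(1)] word_funD(5)[OF w(2)])
qed

lemma word_fun_p:
  "word_fun v \<Longrightarrow> word_fun w \<Longrightarrow> word_fun (\<lambda>u. p (v u) (w u))"
  by (rule word_fun_bin) (simp_all add: p_ac sc_p)
lemma word_fun_mi: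
  "word_fun v \<Longrightarrow> word_fun w \<Longrightarrow> word_fun (\<lambda>u. mi (v u) (w u))"
  by (rule word_fun_bin) (simp_all add: grp sc_mi)
lemma word_fun_sc:
  assumes c: "c \<in> carrier K" and w: "word_fun w"
  shows "word_fun (\<lambda>u. sc c (w u))"
  unfolding word_fun_def
proof (intro conjI allI impI)
  show "sc c (w u) \<in> C" for u using c by simp
  show "sc c (w (u @ x # y # v)) = sc c (w (u @ y # x # v))" for u x y v
    by (simp only: word_funD(2)[OF w, of u x])
  fix a b k u
  show "sc c (w ((p a b, k) # u)) = p (sc c (w ((a, k) # u))) (sc c (w ((b, k) # u)))"
    using c by (simp only: word_funD(3)[OF w] sc_p)
  show "d \<in> carrier K \<Longrightarrow> sc c (w ((sc d a, k) # u)) = sc d (sc c (w ((a, k) # u)))" for d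
    using c by (simp only: word_funD(4)[OF w] sc_mult[symmetric] K.m_comm)
  show "sc c (w ((l a b, k) # u)) = leibniz k (\<lambda>k j. sc c (w ((a, k) # (b, j) # u))) 0 1"
    using c by (simp only: word_funD(5)[OF w]) (rule leibniz_hom, rule sc_p)
qed
lemma word_fun_z: "word_fun (\<lambda>u. z)"
  unfolding word_fun_def by simp
lemma word_fun_leibniz:
  "(\<And>k j. word_fun (G k j)) \<Longrightarrow> word_fun (\<lambda>u. leibniz n (\<lambda>k j. G k j u) k j)"
  by (induction n arbitrary: k j) (simp_all add: word_fun_p)

lemma word_fun_Cons: assumes "word_fun w" shows "word_fun (\<lambda>u. w (c # u))"
  unfolding word_fun_def
proof (intro conjI allI impI)
  note s = word_fun_swap[OF assms, of c]
  show "w (c # u) \<in> C" for u by (rule word_funD[OF assms])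
  show "w (c # u @ x # y # v) = w (c # u @ y # x # v)" for u x y v
    using word_funD(2)[OF assms, of "c # u"] by simp
  fix a b k u
  show "w (c # (p a b, k) # u) = p (w (c # (a, k) # u)) (w (c # (b, k) # u))"
    by (simp add: s word_funD(3)[OF assms])
  show "d \<in> carrier K \<Longrightarrow> w (c # (sc d a, k) # u) = sc d (w (c # (a, k) # u))" for d
    by (simp add: s word_funD(4)[OF assms])
  show "w (c # (l a b, k) # u) = leibniz k (\<lambda>k j. w (c # (a, k) # (b, j) # u)) 0 1"
  proof -
    have "w ((a, k) # c # (b, j) # u) = w (c # (a, k) # (b, j) # u)" for k j
      by (rule word_fun_swap[OF assms])
    moreover have "w ((a, k) # (b, j) # c # u) = w ((a, k) # c # (b, j) # u)" for k j
      using word_funD(2)[OF assms, of "[(a, k)]" "(b, j)" c u] by simp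
    ultimately show ?thesis by (simp only: s word_funD(5)[OF assms])
  qed
qed

section \<open>Hurwitz sequences and the enveloping algebra\<close>

text \<open>The \<open>n\<close>-th entry of a sequence represents the \<open>n\<close>-th derivative, so the derivation is the shift \<open>S\<close>.\<close>

definition seq_fun :: "'n seq \<Rightarrow> bool" where "seq_fun F \<longleftrightarrow> (\<forall>n. word_fun (F n))"
text \<open>Multiplication by a^(k): entry n has to be the n-th derivative of the product, so n
  derivatives are distributed over the letter, from order k on, and the sequence, from entry 0
  on.\<close>

definition hat :: "'n \<Rightarrow> nat \<Rightarrow> 'n seq \<Rightarrow> 'n seq" where
  "hat a k F n u = leibniz n (\<lambda>i j. F j ((a, i) # u)) k 0"
definition S :: "'n seq \<Rightarrow> 'n seq" where "S F n = F (Suc n)"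
definition Z :: "'n seq" where "Z n u = z"
definition Ep :: "'n seq \<Rightarrow> 'n seq \<Rightarrow> 'n seq" where "Ep F G n u = p (F n u) (G n u)"
definition Em :: "'n seq \<Rightarrow> 'n seq \<Rightarrow> 'n seq" where "Em F G n u = mi (F n u) (G n u)"
definition Es :: "'k \<Rightarrow> 'n seq \<Rightarrow> 'n seq" where "Es c F n u = sc c (F n u)"

lemma seq_fun_closed:
  "seq_fun F \<Longrightarrow> F n u \<in> C" by (simp add: seq_fun_def word_funD)
lemma seq_fun_hat: "seq_fun F \<Longrightarrow> seq_fun (hat a k F)"
  unfolding seq_fun_def hat_def[abs_def] by (intro allI word_fun_leibniz word_fun_Cons) simp
lemma seq_fun_S: "seq_fun F \<Longrightarrow> seq_fun (S F)" by (simp add: seq_fun_def S_def)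
lemma seq_fun_Z: "seq_fun Z" by (simp add: seq_fun_def Z_def[abs_def] word_fun_z)
lemma seq_fun_Ep:
  "seq_fun F \<Longrightarrow> seq_fun G \<Longrightarrow> seq_fun (Ep F G)" by (simp add: seq_fun_def Ep_def[abs_def] word_fun_p)
lemma seq_fun_Em:
  "seq_fun F \<Longrightarrow> seq_fun G \<Longrightarrow> seq_fun (Em F G)" by (simp add: seq_fun_def Em_def[abs_def] word_fun_mi)
lemma seq_fun_Es:
  "c \<in> carrier K \<Longrightarrow> seq_fun F \<Longrightarrow> seq_fun (Es c F)" by (simp add: seq_fun_def Es_def[abs_def] word_fun_sc)
lemmas seq_fun_intros = seq_fun_hat seq_fun_S seq_fun_Z seq_fun_Ep seq_fun_Em seq_fun_Es

lemma hat_0: "hat a k F 0 u = F 0 ((a, k) # u)" by (simp add: hat_def)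
lemma hat_Suc: "hat a k F (Suc n) u = p (hat a (Suc k) F n u) (hat a k (S F) n u)"
  using leibniz_shift[of n "\<lambda>i j. F j ((a, i) # u)" k 0] by (simp add: hat_def S_def)

lemma hat_Ep: "hat a k (Ep F G) = Ep (hat a k F) (hat a k G)"
  by (simp add: fun_eq_iff hat_def Ep_def leibniz_p)
lemma hat_Em: "hat a k (Em F G) = Em (hat a k F) (hat a k G)"
  by (simp add: fun_eq_iff hat_def Em_def leibniz_mi)
lemma hat_Es: "c \<in> carrier K \<Longrightarrow> hat a k (Es c F) = Es c (hat a k F)"
  by (simp add: fun_eq_iff hat_def Es_def leibniz_hom[of "sc c"] sc_p)
lemma hat_Z: "hat a k Z = Z" by (simp add: fun_eq_iff hat_def Z_def)
lemma S_hat: "S (hat a k F) = Ep (hat a (Suc k) F) (hat a k (S F))"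
  by (simp add: fun_eq_iff S_def[of "hat _ _ _"] hat_Suc Ep_def)

lemma hat_p: "seq_fun F \<Longrightarrow> hat (p a b) k F = Ep (hat a k F) (hat b k F)"
  by (simp add: fun_eq_iff hat_def Ep_def seq_fun_def word_funD leibniz_p)
lemma hat_sc:
  "seq_fun F \<Longrightarrow> c \<in> carrier K \<Longrightarrow> hat (sc c a) k F = Es c (hat a k F)"
  by (simp add: fun_eq_iff hat_def Es_def seq_fun_def word_funD leibniz_hom[of "sc c"] sc_p)

lemma hat_comm: "seq_fun F \<Longrightarrow> hat a k (hat b j F) = hat b j (hat a k F)"
proof -
  have "hat a k (hat b j F) n u = hat b j (hat a k F) n u" if "seq_fun F" for n u
    using that
  proof (induction n arbitrary: k j F)
    case 0
    then have "word_fun (F 0)" by (simp add: seq_fun_def)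
    then show ?case by (simp only: hat_0) (rule word_fun_swap)
  next
    case (Suc n)
    then show ?case by (simp add: hat_Suc S_hat hat_Ep Ep_def seq_fun_S p_ac)
  qed
  then show "seq_fun F \<Longrightarrow> hat a k (hat b j F) = hat b j (hat a k F)" by (simp add: fun_eq_iff)
qed

text \<open>At entry 0 this is the relation built into \<open>word_fun\<close>; the product rule
  carries it to the later entries.\<close>

lemma hat_l:
  "seq_fun F \<Longrightarrow> hat (l a b) m F n u = leibniz m (\<lambda>k j. hat a k (hat b j F) n u) 0 1"
proof (induction n arbitrary: m F)
  case 0
  then have word_fun: "word_fun (F 0)" by (simp add: seq_fun_def)
  have "F 0 ((a, k) # (b, j) # u) = F 0 ((b, j) # (a, k) # u)" for k j
    by (rule word_fun_swap[OF word_fun])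
  then show ?case by (simp only: hat_0 word_funD(5)[OF word_fun])
next
  case (Suc n)
  let ?G = "\<lambda>F k j. hat a k (hat b j F) n u"
  have "leibniz m (\<lambda>k j. hat a k (hat b j F) (Suc n) u) 0 1 =
    leibniz m (\<lambda>k j. p (p (?G F (Suc k) j) (?G F k (Suc j))) (?G (S F) k j)) 0 1"
    by (simp add: hat_Suc S_hat hat_Ep Ep_def p_ac)
  also have "\<dots> = p (leibniz (Suc m) (?G F) 0 1) (leibniz m (?G (S F)) 0 1)"
    by (simp only: leibniz_p leibniz_shift[of m "?G F"] leibniz_shift'[of m "?G F"] leibniz.simps)
  finally show ?case using Suc by (simp add: hat_Suc seq_fun_S del: leibniz.simps)
qed

text \<open>The element a as the last factor of products: entry n records the weight -1 products of
  all words with a^(n).\<close>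

definition jet :: "'n \<Rightarrow> 'n seq" where "jet a n = Phi ((total_der ^^ n) (const0 a))"

lemma seq_fun_jet: "a \<in> C \<Longrightarrow> seq_fun (jet a)"
  by (simp add: seq_fun_def jet_def word_fun_Phi multi_total_der_pow multi_const0)

text \<open>The empty word recovers a, which makes the embedding injective.\<close>

lemma jet_0: "jet a 0 [] = a" by (simp add: jet_def Phi_def const0_def)

lemma jet_p: "jet (p a b) = Ep (jet a) (jet b)"
proof -
  have "(total_der ^^ n) (const0 (p a b)) = (\<lambda>v. p ((total_der ^^ n) (const0 a) v) ((total_der ^^ n) (const0 b) v))" for n
    by (induction n) (auto simp: const0_def total_der_p)
  then show ?thesis by (intro ext) (simp add: jet_def Ep_def Phi_p)
qed

lemma jet_sc: "c \<in> carrier K \<Longrightarrow> jet (sc c a) = Es c (jet a)"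
proof -
  assume c: "c \<in> carrier K"
  have "(total_der ^^ n) (const0 (sc c a)) = (\<lambda>v. sc c ((total_der ^^ n) (const0 a) v))" for n
    using c by (induction n) (auto simp: const0_def total_der_sc)
  then show ?thesis using c by (intro ext) (simp add: jet_def Es_def Phi_sc)
qed

lemma jet_l: assumes "b \<in> C" shows "jet (l a b) = hat a 0 (S (jet b))"
proof -
  have "jet (l a b) n u = hat a 0 (S (jet b)) n u" for n u
  proof -
    have "(total_der ^^ n) (const0 (l a b)) = (\<lambda>xs. leibniz n (\<lambda>k j. letter a k ((total_der ^^ j) (const0 b)) xs) 0 1)"
      using total_der_pow_const0_l[OF assms] by (rule ext)
    then have "jet (l a b) n u = leibniz n (\<lambda>k j. Phi (letter a k ((total_der ^^ j) (const0 b))) u) 0 1"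
      by (simp only: jet_def Phi_leibniz)
    also have "\<dots> = leibniz n (\<lambda>k j. Phi ((total_der ^^ j) (const0 b)) ((a, k) # u)) 0 (Suc 0)"
      unfolding One_nat_def by (rule leibniz_cong, rule Phi_letter) (simp_all add: multi_total_der multi_total_der_pow multi_const0 assms)
    also have "\<dots> = hat a 0 (S (jet b)) n u"
      using leibniz_shift[of n "\<lambda>i j. jet b j ((a, i) # u)" 0 0] by (simp add: hat_def S_def jet_def)
    finally show ?thesis .
  qed
  then show ?thesis by (simp add: fun_eq_iff)
qed

section \<open>The commutative algebra of operators on sequences\<close>

text \<open>Operators vanish off \<open>seq_fun\<close>, so that equality of functions is equality of operators.\<close>

definition hatE :: "'n \<Rightarrow> nat \<Rightarrow> 'n op" where
  "hatE a k F = (if seq_fun F then hat a k F else Z)"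

inductive_set Q :: "'n op set" where
  hatE: "hatE a k \<in> Q"
| zero: "(\<lambda>F. Z) \<in> Q"
| add: "T \<in> Q \<Longrightarrow> U \<in> Q \<Longrightarrow> (\<lambda>F. Ep (T F) (U F)) \<in> Q"
| scl: "c \<in> carrier K \<Longrightarrow> T \<in> Q \<Longrightarrow> (\<lambda>F. Es c (T F)) \<in> Q"
| comp: "T \<in> Q \<Longrightarrow> U \<in> Q \<Longrightarrow> (\<lambda>F. T (U F)) \<in> Q"

lemma Ep_Z [simp]: "Ep Z Z = Z" by (simp add: fun_eq_iff Ep_def Z_def)
lemma S_Z [simp]: "S Z = Z" by (simp add: fun_eq_iff S_def Z_def)
lemma Es_Z [simp]:
  "c \<in> carrier K \<Longrightarrow> Es c Z = Z" by (simp add: fun_eq_iff Es_def Z_def)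

lemma Q_seq_fun: "T \<in> Q \<Longrightarrow> seq_fun (T F)"
  by (induction arbitrary: F rule: Q.induct) (simp_all add: hatE_def seq_fun_intros)
lemma Q_Z: "T \<in> Q \<Longrightarrow> T Z = Z"
  by (induction rule: Q.induct) (simp_all add: hatE_def hat_Z)
lemma Q_off: "T \<in> Q \<Longrightarrow> \<not> seq_fun F \<Longrightarrow> T F = Z"
  by (induction rule: Q.induct) (simp_all add: hatE_def Q_Z)

lemma Q_Ep:
  "T \<in> Q \<Longrightarrow> seq_fun F \<Longrightarrow> seq_fun G \<Longrightarrow> T (Ep F G) = Ep (T F) (T G)"
  by (induction arbitrary: F G rule: Q.induct)
    (simp_all add: hatE_def hat_Ep seq_fun_intros Q_seq_fun, simp_all add: fun_eq_iff Ep_def Es_def p_ac sc_p)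
lemma Q_Em:
  "T \<in> Q \<Longrightarrow> seq_fun F \<Longrightarrow> seq_fun G \<Longrightarrow> T (Em F G) = Em (T F) (T G)"
  by (induction arbitrary: F G rule: Q.induct)
    (simp_all add: hatE_def hat_Em seq_fun_intros Q_seq_fun, simp_all add: fun_eq_iff Ep_def Em_def Es_def grp sc_mi Z_def)
lemma Q_Es:
  "T \<in> Q \<Longrightarrow> c \<in> carrier K \<Longrightarrow> seq_fun F \<Longrightarrow> T (Es c F) = Es c (T F)"
  by (induction arbitrary: F rule: Q.induct)
    (simp_all add: hatE_def hat_Es seq_fun_intros Q_seq_fun,
      simp_all add: fun_eq_iff Ep_def Es_def sc_p sc_mult[symmetric] K.m_comm)

lemma Q_hat: "T \<in> Q \<Longrightarrow> seq_fun F \<Longrightarrow> T (hat a k F) = hat a k (T F)"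
  by (induction arbitrary: F rule: Q.induct)
    (simp_all add: hatE_def hat_comm hat_Ep hat_Es hat_Z seq_fun_intros Q_seq_fun)

lemma Q_comm: "T \<in> Q \<Longrightarrow> U \<in> Q \<Longrightarrow> T (U F) = U (T F)"
proof (cases "seq_fun F")
  case False
  moreover assume "T \<in> Q" "U \<in> Q"
  ultimately show ?thesis by (simp add: Q_off Q_Z)
next
  case True
  assume T: "T \<in> Q"
  assume "U \<in> Q"
  then show ?thesis using True
    by (induction arbitrary: F rule: Q.induct)
      (simp_all add: hatE_def Q_hat T Q_Z Q_Ep Q_Es Q_seq_fun seq_fun_intros)
qed

text \<open>The commutator with the shift obeys the product rule for composition and sends a^(k) to
  a^(k+1). The case distinction matters because the shift of a sequence outside
  \<open>seq_fun\<close> may lie inside.\<close>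

definition dQ :: "'n op \<Rightarrow> 'n op" where
  "dQ T F = (if seq_fun F then Em (S (T F)) (T (S F)) else Z)"

lemma dQ_Ep: "dQ (\<lambda>F. Ep (T F) (U F)) = (\<lambda>F. Ep (dQ T F) (dQ U F))"
  by (auto simp: dQ_def fun_eq_iff Ep_def Em_def S_def Z_def grp)
lemma dQ_Es:
  "c \<in> carrier K \<Longrightarrow> dQ (\<lambda>F. Es c (T F)) = (\<lambda>F. Es c (dQ T F))"
  by (auto simp: dQ_def fun_eq_iff Es_def Em_def S_def Z_def sc_mi)
lemma dQ_comp:
  "T \<in> Q \<Longrightarrow> U \<in> Q \<Longrightarrow> dQ (\<lambda>F. T (U F)) = (\<lambda>F. Ep (dQ T (U F)) (T (dQ U F)))"
proof
  fix F assume TU: "T \<in> Q" "U \<in> Q"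
  show "dQ (\<lambda>F. T (U F)) F = Ep (dQ T (U F)) (T (dQ U F))"
  proof (cases "seq_fun F")
    case True
    then show ?thesis using TU
      by (simp add: dQ_def Q_Em Q_seq_fun seq_fun_intros) (simp add: fun_eq_iff Ep_def Em_def grp)
  next
    case False
    then show ?thesis using TU
      by (simp add: dQ_def Q_off Q_Z seq_fun_Z) (simp add: Q_Z fun_eq_iff Ep_def Em_def Z_def)
  qed
qed
lemma dQ_hat: "dQ (hatE a k) = hatE a (Suc k)"
  by (auto simp: fun_eq_iff dQ_def hatE_def seq_fun_S Em_def S_hat Ep_def grp mi_eq hat_def leibniz_closed seq_fun_closed)

lemma dQ_Q: "T \<in> Q \<Longrightarrow> dQ T \<in> Q"
proof (induction rule: Q.induct)
  case zero
  have "dQ (\<lambda>F. Z) = (\<lambda>F. Z)" by (simp add: fun_eq_iff dQ_def Em_def S_def Z_def)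
  then show ?case by (simp add: Q.zero)
qed (simp_all add: dQ_Ep dQ_Es dQ_comp dQ_hat Q.intros)

section \<open>The enveloping differential Perm-algebra\<close>

definition P :: "('k, 'n op \<times> 'n seq) module" where
  "P = \<lparr>carrier = {(T, F). T \<in> Q \<and> seq_fun F}, mult = (\<lambda>x y. undefined), one = undefined,
    zero = (\<lambda>F. Z, Z), add = (\<lambda>(T, F) (U, G). (\<lambda>H. Ep (T H) (U H), Ep F G)),
    smult = (\<lambda>c (T, F). (\<lambda>H. Es c (T H), Es c F))\<rparr>"

definition mul :: "'n op \<times> 'n seq \<Rightarrow> 'n op \<times> 'n seq \<Rightarrow> 'n op \<times> 'n seq" where
  "mul = (\<lambda>(T, F) (U, G). (\<lambda>H. T (U H), T G))"
definition der :: "'n op \<times> 'n seq \<Rightarrow> 'n op \<times> 'n seq" where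
  "der = (\<lambda>(T, F). (dQ T, S F))"
text \<open>The components are the two roles of a in a Perm product: before the last position it
  acts as an operator, in the last position it is what the operators act on.\<close>

definition emb :: "'n \<Rightarrow> 'n op \<times> 'n seq" where
  "emb a = (hatE a 0, jet a)"

lemma P_simps:
  "carrier P = {(T, F). T \<in> Q \<and> seq_fun F}" "\<zero>\<^bsub>P\<^esub> = (\<lambda>F. Z, Z)"
  "(T, F) \<oplus>\<^bsub>P\<^esub> (U, G) = (\<lambda>H. Ep (T H) (U H), Ep F G)"
  "c \<odot>\<^bsub>P\<^esub> (T, F) = (\<lambda>H. Es c (T H), Es c F)"
  by (simp_all add: P_def)

lemma sc_zero: "sc \<zero>\<^bsub>K\<^esub> x = z"
  using sc_add[of "\<zero>\<^bsub>K\<^esub>" "\<zero>\<^bsub>K\<^esub>" x] p_cancel[of "sc \<zero>\<^bsub>K\<^esub> x" z "sc \<zero>\<^bsub>K\<^esub> x"] by simp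

lemma Ep_neg:
  "seq_fun F \<Longrightarrow> Ep (Es (\<ominus>\<^bsub>K\<^esub> \<one>\<^bsub>K\<^esub>) F) F = Z"
proof -
  assume F: "seq_fun F"
  have "p (sc (\<ominus>\<^bsub>K\<^esub> \<one>\<^bsub>K\<^esub>) (F n u)) (F n u) = z" for n u
    using sc_add[of "\<ominus>\<^bsub>K\<^esub> \<one>\<^bsub>K\<^esub>" "\<one>\<^bsub>K\<^esub>" "F n u"] seq_fun_closed[OF F]
    by (simp add: K.l_neg sc_zero)
  then show ?thesis by (simp add: fun_eq_iff Ep_def Es_def Z_def)
qed

lemma seq_fun_rules:
  "Ep (Ep F G) H = Ep F (Ep G H)" "seq_fun F \<Longrightarrow> Ep Z F = F" "Ep F G = Ep G F"
  "c \<in> carrier K \<Longrightarrow> Es c (Ep F G) = Ep (Es c F) (Es c G)"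
  "c \<in> carrier K \<Longrightarrow> c' \<in> carrier K \<Longrightarrow> Es (c \<oplus>\<^bsub>K\<^esub> c') F = Ep (Es c F) (Es c' F)"
  "c \<in> carrier K \<Longrightarrow> c' \<in> carrier K \<Longrightarrow> Es (c \<otimes>\<^bsub>K\<^esub> c') F = Es c (Es c' F)"
  "seq_fun F \<Longrightarrow> Es \<one>\<^bsub>K\<^esub> F = F"
  by (simp_all add: fun_eq_iff Ep_def Es_def Z_def p_assoc sc_p sc_add sc_mult seq_fun_closed)
    (simp add: p_comm)

lemma module_P: "module K P"
proof (rule moduleI)
  show "cring K" by (rule K.is_cring)
  show "abelian_group P"
  proof (rule abelian_groupI)
    fix x assume "x \<in> carrier P"
    then obtain T F where x: "x = (T, F)" "T \<in> Q" "seq_fun F" by (auto simp: P_simps)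
    show "\<exists>y\<in>carrier P. y \<oplus>\<^bsub>P\<^esub> x = \<zero>\<^bsub>P\<^esub>"
      \<comment> \<open>Taken as a scalar multiple, the negative stays in \<open>Q\<close> by the
        rule \<open>scl\<close>.\<close>
      by (rule bexI[of _ "(\<ominus>\<^bsub>K\<^esub> \<one>\<^bsub>K\<^esub>) \<odot>\<^bsub>P\<^esub> x"])
        (use x in \<open>auto simp: P_simps Ep_neg Q_seq_fun Q.scl seq_fun_Es\<close>)
  qed (auto simp: P_simps Q.intros seq_fun_intros Q_seq_fun seq_fun_rules(1,2), (rule seq_fun_rules ext)+)
qed (auto simp: P_simps Q.intros seq_fun_intros Q_seq_fun seq_fun_rules(4-7))

lemma perm_P: "differential_perm_algebra K P mul der"
  unfolding differential_perm_algebra_def perm_algebra_def linear_space_def derivation_def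
proof (intro conjI)
  show "field K" by (rule K.field_axioms)
  show "module K P" by (rule module_P)
  show "bilinear_op K P mul"
    by (auto simp: bilinear_op_def linear_on_def P_simps mul_def Q.intros Q_seq_fun Q_Ep Q_Es)
  show "linear_on K P P der"
    by (auto simp: linear_on_def P_simps der_def dQ_Q seq_fun_S dQ_Ep dQ_Es)
      (simp_all add: fun_eq_iff Ep_def Es_def S_def)
  \<comment> \<open>In the second component this is S T G = (S T - T S) G + T S G.\<close>
  show "\<forall>x\<in>carrier P. \<forall>y\<in>carrier P. der (mul x y) = mul (der x) y \<oplus>\<^bsub>P\<^esub> mul x (der y)"
    by (auto simp: P_simps der_def mul_def dQ_comp) (simp add: dQ_def fun_eq_iff Ep_def Em_def grp mi_eq seq_fun_closed Q_seq_fun S_def eq_mi)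
  show "\<forall>x\<in>carrier P. \<forall>y\<in>carrier P. \<forall>w\<in>carrier P.
    mul (mul x y) w = mul x (mul y w) \<and> mul (mul x y) w = mul (mul y x) w"
    by (auto simp: P_simps mul_def Q_comm)
qed

lemma emb_closed: "a \<in> C \<Longrightarrow> emb a \<in> carrier P"
  by (simp add: emb_def P_simps Q.hatE seq_fun_jet)
lemma emb_p: "emb (p a b) = emb a \<oplus>\<^bsub>P\<^esub> emb b"
  by (auto simp: emb_def P_simps jet_p hatE_def hat_p fun_eq_iff)
lemma emb_sc: "c \<in> carrier K \<Longrightarrow> emb (sc c a) = c \<odot>\<^bsub>P\<^esub> emb a"
  by (auto simp: emb_def P_simps jet_sc hatE_def hat_sc fun_eq_iff)
lemma emb_inj: "emb a = emb b \<Longrightarrow> a = b"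
  by (metis emb_def jet_0 prod.inject)
lemma hatE_l: "hatE (l a b) 0 = (\<lambda>F. hatE a 0 (hatE b 1 F))"
  by (auto simp: fun_eq_iff hatE_def hat_l seq_fun_hat hat_Z seq_fun_Z)
lemma emb_l: "b \<in> C \<Longrightarrow> emb (l a b) = mul (emb a) (der (emb b))"
  by (simp add: emb_def mul_def der_def jet_l hatE_l dQ_hat) (simp add: hatE_def seq_fun_S seq_fun_jet)

end

section \<open>The two passages between Novikov dialgebras and differential Perm-algebras\<close>

lemma novikov_dialgebra_embeds:
  assumes "novikov_dialgebra K N l r"
  obtains P :: "('k, 'n op \<times> 'n seq) module"
    and mul der emb
  where "differential_perm_algebra K P mul der" "diff_perm_embedding K (N :: ('k, 'n, 'l) module_scheme) l P mul der emb"
proof -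
  have N: "field K" "module K N" "bilinear_op K N l" "bilinear_op K N r"
    using assms by (auto simp: novikov_dialgebra_def linear_space_def)
  interpret K: field K by (rule N)
  interpret N: module K N by (rule N)
  have cl: "l x y \<in> carrier N" "r x y \<in> carrier N" if "x \<in> carrier N" "y \<in> carrier N" for x y
    using N that by (auto simp: bilinear_op_def linear_on_def)
  have add: "l x (y \<oplus>\<^bsub>N\<^esub> w) = l x y \<oplus>\<^bsub>N\<^esub> l x w" "l (x \<oplus>\<^bsub>N\<^esub> y) w = l x w \<oplus>\<^bsub>N\<^esub> l y w"
      "r x (y \<oplus>\<^bsub>N\<^esub> w) = r x y \<oplus>\<^bsub>N\<^esub> r x w" "r (x \<oplus>\<^bsub>N\<^esub> y) w = r x w \<oplus>\<^bsub>N\<^esub> r y w"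
    if "x \<in> carrier N" "y \<in> carrier N" "w \<in> carrier N" for x y w
    using N that by (auto simp: bilinear_op_def linear_on_def)
  have scl: "l x (c \<odot>\<^bsub>N\<^esub> y) = c \<odot>\<^bsub>N\<^esub> l x y" "l (c \<odot>\<^bsub>N\<^esub> x) y = c \<odot>\<^bsub>N\<^esub> l x y"
      "r x (c \<odot>\<^bsub>N\<^esub> y) = c \<odot>\<^bsub>N\<^esub> r x y" "r (c \<odot>\<^bsub>N\<^esub> x) y = c \<odot>\<^bsub>N\<^esub> r x y"
    if "x \<in> carrier N" "y \<in> carrier N" "c \<in> carrier K" for x y c
    using N that by (auto simp: bilinear_op_def linear_on_def)
  have minus: "a \<ominus>\<^bsub>N\<^esub> b = c \<ominus>\<^bsub>N\<^esub> d \<longleftrightarrow> a \<oplus>\<^bsub>N\<^esub> d = c \<oplus>\<^bsub>N\<^esub> b"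
    if "a \<in> carrier N" "b \<in> carrier N" "c \<in> carrier N" "d \<in> carrier N" for a b c d
  proof -
    have "a \<ominus>\<^bsub>N\<^esub> b = c \<ominus>\<^bsub>N\<^esub> d \<longleftrightarrow> (a \<ominus>\<^bsub>N\<^esub> b) \<oplus>\<^bsub>N\<^esub> (b \<oplus>\<^bsub>N\<^esub> d) = (c \<ominus>\<^bsub>N\<^esub> d) \<oplus>\<^bsub>N\<^esub> (b \<oplus>\<^bsub>N\<^esub> d)"
      using that by simp
    also have "(a \<ominus>\<^bsub>N\<^esub> b) \<oplus>\<^bsub>N\<^esub> (b \<oplus>\<^bsub>N\<^esub> d) = a \<oplus>\<^bsub>N\<^esub> d"
      using that by (simp add: a_minus_def N.a_assoc N.r_neg1 N.r_neg2)
    also have "(c \<ominus>\<^bsub>N\<^esub> d) \<oplus>\<^bsub>N\<^esub> (b \<oplus>\<^bsub>N\<^esub> d) = c \<oplus>\<^bsub>N\<^esub> b"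
      using that by (subst N.a_comm[of b d]) (simp_all add: a_minus_def N.a_assoc N.r_neg1 N.r_neg2)
    finally show ?thesis .
  qed
  have ids: "l (r x y) w = l (l x y) w" "r x (l y w) = r x (r y w)"
    "r (r x y) w \<oplus>\<^bsub>N\<^esub> l y (r x w) = r (l y x) w \<oplus>\<^bsub>N\<^esub> r x (r y w)"
    "l (l x y) w \<oplus>\<^bsub>N\<^esub> l y (l x w) = l (l y x) w \<oplus>\<^bsub>N\<^esub> l x (l y w)"
    "r (r x y) w = r (r x w) y" "r (l x y) w = l (l x w) y"
    if "x \<in> carrier N" "y \<in> carrier N" "w \<in> carrier N" for x y w
  proof -
    have *: "l (r x y) w = l (l x y) w \<and> r x (l y w) = r x (r y w) \<and>
      r (r x y) w \<ominus>\<^bsub>N\<^esub> r x (r y w) = r (l y x) w \<ominus>\<^bsub>N\<^esub> l y (r x w) \<and>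
      l (l x y) w \<ominus>\<^bsub>N\<^esub> l x (l y w) = l (l y x) w \<ominus>\<^bsub>N\<^esub> l y (l x w) \<and>
      r (r x y) w = r (r x w) y \<and> r (l x y) w = l (l x w) y"
      using assms that unfolding novikov_dialgebra_def by blast
    then show "l (r x y) w = l (l x y) w" "r x (l y w) = r x (r y w)"
      "r (r x y) w = r (r x w) y" "r (l x y) w = l (l x w) y" by blast+
    have "r (r x y) w \<ominus>\<^bsub>N\<^esub> r x (r y w) = r (l y x) w \<ominus>\<^bsub>N\<^esub> l y (r x w)"
      "l (l x y) w \<ominus>\<^bsub>N\<^esub> l x (l y w) = l (l y x) w \<ominus>\<^bsub>N\<^esub> l y (l x w)"
      using * by blast+
    then show "r (r x y) w \<oplus>\<^bsub>N\<^esub> l y (r x w) = r (l y x) w \<oplus>\<^bsub>N\<^esub> r x (r y w)"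
      "l (l x y) w \<oplus>\<^bsub>N\<^esub> l y (l x w) = l (l y x) w \<oplus>\<^bsub>N\<^esub> l x (l y w)"
      using that by (simp_all only: minus cl)
  qed
  \<comment> \<open>Reading arguments outside the carrier as zero turns the operations into the
    total ones that \<open>total_group\<close> and \<open>total_novikov\<close> ask for.\<close>
  define rho where "rho x = (if x \<in> carrier N then x else \<zero>\<^bsub>N\<^esub>)" for x
  have rho [simp]: "rho x \<in> carrier N" "x \<in> carrier N \<Longrightarrow> rho x = x" for x
    by (auto simp: rho_def)
  let ?l = "\<lambda>x y. l (rho x) (rho y)" and ?r = "\<lambda>x y. r (rho x) (rho y)"
  let ?p = "\<lambda>x y. rho x \<oplus>\<^bsub>N\<^esub> rho y" and ?mi = "\<lambda>x y. rho x \<ominus>\<^bsub>N\<^esub> rho y"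
  interpret total_group "carrier N" ?p ?mi "\<zero>\<^bsub>N\<^esub>"
  proof
    have mi: "a \<ominus>\<^bsub>N\<^esub> b = c \<longleftrightarrow> a = c \<oplus>\<^bsub>N\<^esub> b"
      if "a \<in> carrier N" "b \<in> carrier N" "c \<in> carrier N" for a b c
      using minus[of a b c "\<zero>\<^bsub>N\<^esub>"] that N.minus_equality[of "\<zero>\<^bsub>N\<^esub>" "\<zero>\<^bsub>N\<^esub>"]
      by (simp add: a_minus_def)
    fix x y w v
    show "?p x (?mi y w) = ?mi (?p x y) w"
      by (simp add: a_minus_def N.a_assoc)
    show "?mi (?mi x y) w = ?mi x (?p y w)" "?mi x (?mi y w) = ?mi (?p x w) y"
      by (simp_all add: a_minus_def N.minus_add N.a_ac)
    show "?mi x y = ?mi v w \<longleftrightarrow> ?p x w = ?p v y" by (simp add: minus)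
    show "x \<in> carrier N \<Longrightarrow> v \<in> carrier N \<Longrightarrow> ?mi x y = v \<longleftrightarrow> x = ?p v y" by (simp add: mi)
  qed (simp_all add: N.a_ac)
  interpret total_novikov "carrier N" ?p ?mi "\<zero>\<^bsub>N\<^esub>" K "\<lambda>c x. c \<odot>\<^bsub>N\<^esub> rho x" ?l ?r
  proof
    fix x y w
    show "?l (?r x y) w = ?l (?l x y) w" "?r x (?l y w) = ?r x (?r y w)"
      "?r (?r x y) w = ?r (?r x w) y" "?r (?l x y) w = ?l (?l x w) y"
      "?p (?r (?r x y) w) (?l y (?r x w)) = ?p (?r (?l y x) w) (?r x (?r y w))"
      "?p (?l (?l x y) w) (?l y (?l x w)) = ?p (?l (?l y x) w) (?l x (?l y w))"
      using ids[of "rho x" "rho y" "rho w"] by (simp_all only: rho cl)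
  qed (simp_all add: cl add scl N.smult_r_distr N.smult_l_distr N.smult_assoc1)
  \<comment> \<open>On the carrier the total operations are the original ones, so the facts on
    \<open>emb\<close> can be transferred.\<close>
  have p: "a \<oplus>\<^bsub>N\<^esub> b = ?p a b" and l: "l a b = ?l a b" if "a \<in> carrier N" "b \<in> carrier N" for a b
    using that by simp_all
  have s: "c \<odot>\<^bsub>N\<^esub> a = c \<odot>\<^bsub>N\<^esub> rho a" if "a \<in> carrier N" for a c
    using that by simp
  have "diff_perm_embedding K N l P mul der emb"
    unfolding diff_perm_embedding_def linear_on_def
  proof (intro conjI ballI)
    fix a assume a: "a \<in> carrier N"
    show "emb a \<in> carrier P" by (rule emb_closed[OF a])
    show "emb (c \<odot>\<^bsub>N\<^esub> a) = c \<odot>\<^bsub>P\<^esub> emb a" if "c \<in> carrier K" for c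
      unfolding s[OF a] by (rule emb_sc[OF that])
    fix b assume b: "b \<in> carrier N"
    show "emb (a \<oplus>\<^bsub>N\<^esub> b) = emb a \<oplus>\<^bsub>P\<^esub> emb b" unfolding p[OF a b] by (rule emb_p)
    show "emb (l a b) = mul (emb a) (der (emb b))" unfolding l[OF a b] by (rule emb_l[OF b])
  qed (auto intro: inj_onI emb_inj)
  then show thesis by (rule that[OF perm_P])
qed

text \<open>In both left symmetry laws the products of first derivatives cancel after
  differentiation. What remains is -x y z'' for |- and -z'' y x for -|, and the Perm law permutes
  all factors but the last.\<close>

lemma diff_perm_algebra_novikov_dialgebra:
  assumes P: "differential_perm_algebra K P mul d"
  shows "novikov_dialgebra K P (\<lambda>x y. mul x (d y)) (\<lambda>x y. mul (d y) x)"
proof -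
  have lin: "linear_space K P" and mul: "bilinear_op K P mul" and d: "linear_on K P P d"
    and leib: "\<And>x y. x \<in> carrier P \<Longrightarrow> y \<in> carrier P \<Longrightarrow> d (mul x y) = mul (d x) y \<oplus>\<^bsub>P\<^esub> mul x (d y)"
    and assoc: "\<And>x y z. x \<in> carrier P \<Longrightarrow> y \<in> carrier P \<Longrightarrow> z \<in> carrier P \<Longrightarrow>
      mul (mul x y) z = mul x (mul y z)"
    and perm: "\<And>x y z. x \<in> carrier P \<Longrightarrow> y \<in> carrier P \<Longrightarrow> z \<in> carrier P \<Longrightarrow>
      mul (mul x y) z = mul (mul y x) z"
    using P unfolding differential_perm_algebra_def perm_algebra_def derivation_def by blast+
  interpret module K P using lin by (simp add: linear_space_def)
  have cl: "x \<in> carrier P \<Longrightarrow> d x \<in> carrier P"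
    "x \<in> carrier P \<Longrightarrow> y \<in> carrier P \<Longrightarrow> mul x y \<in> carrier P" for x y
    using linear_on_closed[OF d] bilinear_op_closed[OF mul] by auto
  have lcomm: "mul x (mul y z) = mul y (mul x z)"
    if "x \<in> carrier P" "y \<in> carrier P" "z \<in> carrier P" for x y z
    using that by (metis assoc perm)
  have add: "mul x (y \<oplus>\<^bsub>P\<^esub> z) = mul x y \<oplus>\<^bsub>P\<^esub> mul x z" "mul (y \<oplus>\<^bsub>P\<^esub> z) x = mul y x \<oplus>\<^bsub>P\<^esub> mul z x"
    if "x \<in> carrier P" "y \<in> carrier P" "z \<in> carrier P" for x y z
    using mul that unfolding bilinear_op_def linear_on_def by blast+
  have cancel: "a \<ominus>\<^bsub>P\<^esub> (b \<oplus>\<^bsub>P\<^esub> a) = \<ominus>\<^bsub>P\<^esub> b" "a \<ominus>\<^bsub>P\<^esub> (a \<oplus>\<^bsub>P\<^esub> b) = \<ominus>\<^bsub>P\<^esub> b"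
    if "a \<in> carrier P" "b \<in> carrier P" for a b
    using that by (simp_all add: a_minus_def M.minus_add M.r_neg M.r_neg1 M.r_neg2 M.a_ac)
  have bil: "bilinear_op K P (\<lambda>x y. mul x (d y))" "bilinear_op K P (\<lambda>x y. mul (d y) x)"
    using mul d by (auto simp: bilinear_op_def linear_on_def)
  show ?thesis
    unfolding novikov_dialgebra_def
  proof (intro conjI ballI lin bil)
    fix x y z assume xyz: "x \<in> carrier P" "y \<in> carrier P" "z \<in> carrier P"
    note c = xyz cl
    show "mul (mul (d y) x) (d z) = mul (mul x (d y)) (d z)"
      using c by (simp add: perm)
    show "mul (d (mul y (d z))) x = mul (d (mul (d z) y)) x"
      using c by (simp add: leib add assoc lcomm M.a_comm)
    show "mul (d z) (mul (d y) x) \<ominus>\<^bsub>P\<^esub> mul (d (mul (d z) y)) x =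
      mul (d z) (mul y (d x)) \<ominus>\<^bsub>P\<^esub> mul y (d (mul (d z) x))"
      using c by (simp add: leib add assoc lcomm cancel)
    show "mul (mul x (d y)) (d z) \<ominus>\<^bsub>P\<^esub> mul x (d (mul y (d z))) =
      mul (mul y (d x)) (d z) \<ominus>\<^bsub>P\<^esub> mul y (d (mul x (d z)))"
      using c by (simp add: leib add assoc lcomm cancel)
    show "mul (d z) (mul (d y) x) = mul (d y) (mul (d z) x)"
      using c by (simp add: lcomm)
    show "mul (d z) (mul x (d y)) = mul (mul x (d z)) (d y)"
      using c by (simp add: assoc lcomm)
  qed
qed

theorem corollary1:
  fixes K :: "('k, 'm) ring_scheme" and A :: "('k, 'a, 'n) module_scheme"
    and circ :: "'a \<Rightarrow> 'a \<Rightarrow> 'a"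
  assumes "left_symmetric_algebra K A circ"
  shows "embeds_in_diff_perm_algebra K A circ \<longleftrightarrow> embeds_in_novikov_dialgebra K A circ"
proof
  assume "embeds_in_diff_perm_algebra K A circ"
  then obtain P :: "('k, ('k, 'a) univ) module" and mul d \<theta>
    where "differential_perm_algebra K P mul d" "diff_perm_embedding K A circ P mul d \<theta>"
    unfolding embeds_in_diff_perm_algebra_def by blast
  then show "embeds_in_novikov_dialgebra K A circ"
    unfolding embeds_in_novikov_dialgebra_def novikov_embedding_def diff_perm_embedding_def
    using diff_perm_algebra_novikov_dialgebra by blast
next
  assume "embeds_in_novikov_dialgebra K A circ"
  then obtain N :: "('k, ('k, 'a) univ) module" and l r \<theta>
    where N: "novikov_dialgebra K N l r" and \<theta>: "novikov_embedding K A circ N l r \<theta>"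
    unfolding embeds_in_novikov_dialgebra_def by blast
  \<comment> \<open>This algebra lives over a type of operators and sequences;
    \<open>embeds_in_diff_perm_algebraI\<close> finally brings the composite embedding back to the
    fixed type.\<close>
  obtain P :: "('k, (('k, 'a) univ op \<times> ('k, 'a) univ seq)) module" and mul d \<eta>
    where P: "differential_perm_algebra K P mul d" and \<eta>: "diff_perm_embedding K N l P mul d \<eta>"
    by (rule novikov_dialgebra_embeds[OF N])
  have "linear_on K A P (\<eta> \<circ> \<theta>)"
    using \<theta> \<eta> by (auto simp: novikov_embedding_def diff_perm_embedding_def linear_on_def)
  moreover have "inj_on (\<eta> \<circ> \<theta>) (carrier A)"
    using \<theta> \<eta> unfolding novikov_embedding_def diff_perm_embedding_def linear_on_def
    by (intro comp_inj_on) (auto intro: inj_on_subset)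
  moreover have "(\<eta> \<circ> \<theta>) (circ a b) = mul ((\<eta> \<circ> \<theta>) a) (d ((\<eta> \<circ> \<theta>) b))"
    if "a \<in> carrier A" "b \<in> carrier A" for a b
    using that \<theta> \<eta> by (auto simp: novikov_embedding_def diff_perm_embedding_def linear_on_def)
  ultimately have "diff_perm_embedding K A circ P mul d (\<eta> \<circ> \<theta>)"
    by (simp add: diff_perm_embedding_def)
  then show "embeds_in_diff_perm_algebra K A circ"
    using assms P by (intro embeds_in_diff_perm_algebraI) (auto simp: left_symmetric_algebra_def)
qed

end
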